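(* The problem Reachable State Recognition — given an open shop system and a state $s$, decide whether $s$ can be reached from the initial state $0$ — can be decided in polynomial time.
   Context: An open shop system consists of $n$ jobs $J_1,\ldots,J_n$ and $m$ machines $M_1,\ldots,M_m$. Each job $J_j$ has a set $\mathcal{M}(J_j)\subseteq\{M_1,\ldots,M_m\}$ of machines on which it must be processed, in an arbitrary order; each machine $M_i$ has a positive integer capacity $\mathrm{cap}(M_i)$. There are two artificial machines $M_0$ and $M_{m+1}$ of unbounded capacity. A state $s$ specifies for every job $J_j$ a machine $M^s(J_j)\in\{M_0,\ldots,M_{m+1}\}$ on which it currently sits and a set $\mathcal{M}^s(J_j)\subseteq\mathcal{M}(J_j)\setminus\{M^s(J_j)\}$ of machines on which it still needs processing; each machine $M_i$, $1\le i\le m$, holds at most $\mathrm{cap}(M_i)$ jobs. The initial state $0$ has $M^0(J_j)=M_0$, $\mathcal{M}^0(J_j)=\mathcal{M}(J_j)$ for all $j$. A successor of $s$ arises by moving a single job $J_j$ from $M^s(J_j)$ to a machine $M\in\mathcal{M}^s(J_j)$ holding fewer than $\mathrm{cap}(M)$ jobs (removing $M$ from its remaining set), or by moving a job with $\mathcal{M}^s(J_j)=\emptyset$, $M^s(J_j)\ne M_{m+1}$ to $M_{m+1}$. A state is reachable from $0$ if it can be obtained from $0$ by finitely many successor steps. *)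

theory Defs
  imports "HOL-Computational_Algebra.Polynomial"
begin

section \<open>Open shop systems\<close>

text \<open>
  Jobs are \<open>1, \<dots>, n\<close> and proper machines are \<open>1, \<dots>, m\<close>; the machine indices \<open>0\<close> and
  \<open>m + 1\<close> stand for the two artificial machines of unbounded capacity.
\<close>

record open_shop =
  njobs :: nat
  nmach :: nat
  mset_of :: "nat \<Rightarrow> nat set"
  cap :: "nat \<Rightarrow> nat"

record shop_state =
  loc :: "nat \<Rightarrow> nat"
  todo :: "nat \<Rightarrow> nat set"

definition is_open_shop :: "open_shop \<Rightarrow> bool" where
  "is_open_shop S \<longleftrightarrow>
     (\<forall>j\<in>{1..njobs S}. mset_of S j \<subseteq> {1..nmach S}) \<and>
     (\<forall>i\<in>{1..nmach S}. cap S i > 0)"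

definition load :: "open_shop \<Rightarrow> shop_state \<Rightarrow> nat \<Rightarrow> nat" where
  "load S s i = card {j\<in>{1..njobs S}. loc s j = i}"

text \<open>
  The last conjunct only fixes the values of the two total functions on indices that are not
  jobs, so that states that agree on all jobs are equal.
\<close>

definition is_state :: "open_shop \<Rightarrow> shop_state \<Rightarrow> bool" where
  "is_state S s \<longleftrightarrow>
     (\<forall>j\<in>{1..njobs S}. loc s j \<in> {0..nmach S + 1} \<and> todo s j \<subseteq> mset_of S j - {loc s j}) \<and>
     (\<forall>i\<in>{1..nmach S}. load S s i \<le> cap S i) \<and>
     (\<forall>j. j \<notin> {1..njobs S} \<longrightarrow> loc s j = 0 \<and> todo s j = {})"

definition initial_state :: "open_shop \<Rightarrow> shop_state" where
  "initial_state S =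
     \<lparr>loc = (\<lambda>j. 0), todo = (\<lambda>j. if j \<in> {1..njobs S} then mset_of S j else {})\<rparr>"

inductive successor :: "open_shop \<Rightarrow> shop_state \<Rightarrow> shop_state \<Rightarrow> bool" for S where
  move: "\<lbrakk>j \<in> {1..njobs S}; i \<in> todo s j; load S s i < cap S i\<rbrakk> \<Longrightarrow>
     successor S s \<lparr>loc = (loc s)(j := i), todo = (todo s)(j := todo s j - {i})\<rparr>"
| leave: "\<lbrakk>j \<in> {1..njobs S}; todo s j = {}; loc s j \<noteq> nmach S + 1\<rbrakk> \<Longrightarrow>
     successor S s \<lparr>loc = (loc s)(j := nmach S + 1), todo = todo s\<rparr>"

definition reachable :: "open_shop \<Rightarrow> shop_state \<Rightarrow> bool" where
  "reachable S s \<longleftrightarrow> (successor S)\<^sup>*\<^sup>* (initial_state S) s"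


section \<open>Polynomial time on random access machines with logarithmic cost\<close>

text \<open>Binary notation, most significant bit first; \<open>0\<close> is the empty word.\<close>

fun binary :: "nat \<Rightarrow> bool list" where
  "binary x = (if x = 0 then [] else binary (x div 2) @ [odd x])"

declare binary.simps [simp del]

definition bitlen :: "nat \<Rightarrow> nat" where
  "bitlen x = max 1 (length (binary x))"

text \<open>
  The machine is the random access machine of Cook and Reckhow with natural numbers in the
  registers \<open>X\<^sub>0, X\<^sub>1, \<dots>\<close>, truncated subtraction, and a one-way input tape over the bits. An
  instruction is charged the total binary length of the register addresses and operands that
  it uses.

  \<^item> \<open>Const i c\<close>: \<open>X\<^sub>i := c\<close>
  \<^item> \<open>Add i j k\<close>: \<open>X\<^sub>i := X\<^sub>j + X\<^sub>k\<close>
  \<^item> \<open>Sub i j k\<close>: \<open>X\<^sub>i := X\<^sub>j - X\<^sub>k\<close>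
  \<^item> \<open>Load i j\<close>: \<open>X\<^sub>i\<close> receives the content of the register with address \<open>X\<^sub>j\<close>
  \<^item> \<open>Store i j\<close>: the register with address \<open>X\<^sub>i\<close> receives \<open>X\<^sub>j\<close>
  \<^item> \<open>Jump j l\<close>: continue at instruction \<open>l\<close> if \<open>X\<^sub>j > 0\<close>
  \<^item> \<open>Read i\<close>: \<open>X\<^sub>i\<close> receives the next input bit, or \<open>2\<close> once the input is exhausted
\<close>

datatype instr =
    Const nat nat
  | Add nat nat nat
  | Sub nat nat nat
  | Load nat nat
  | Store nat nat
  | Jump nat nat
  | Read nat
  | Accept
  | Reject

text \<open>Instruction counter, registers, and the unread part of the input.\<close>

type_synonym config = "nat \<times> (nat \<Rightarrow> nat) \<times> bool list"

fun exec :: "instr \<Rightarrow> config \<Rightarrow> config" where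
  "exec (Const i c) (pc, X, w) = (pc + 1, X(i := c), w)"
| "exec (Add i j k) (pc, X, w) = (pc + 1, X(i := X j + X k), w)"
| "exec (Sub i j k) (pc, X, w) = (pc + 1, X(i := X j - X k), w)"
| "exec (Load i j) (pc, X, w) = (pc + 1, X(i := X (X j)), w)"
| "exec (Store i j) (pc, X, w) = (pc + 1, X(X i := X j), w)"
| "exec (Jump j l) (pc, X, w) = (if X j > 0 then l else pc + 1, X, w)"
| "exec (Read i) (pc, X, []) = (pc + 1, X(i := 2), [])"
| "exec (Read i) (pc, X, b # w) = (pc + 1, X(i := of_bool b), w)"
| "exec Accept c = c"
| "exec Reject c = c"

fun cost :: "instr \<Rightarrow> (nat \<Rightarrow> nat) \<Rightarrow> nat" where
  "cost (Const i c) X = bitlen i + bitlen c"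
| "cost (Add i j k) X = bitlen i + bitlen j + bitlen k + bitlen (X j) + bitlen (X k)"
| "cost (Sub i j k) X = bitlen i + bitlen j + bitlen k + bitlen (X j) + bitlen (X k)"
| "cost (Load i j) X = bitlen i + bitlen j + bitlen (X j) + bitlen (X (X j))"
| "cost (Store i j) X = bitlen i + bitlen j + bitlen (X i) + bitlen (X j)"
| "cost (Jump j l) X = bitlen j + bitlen (X j)"
| "cost (Read i) X = bitlen i + 1"
| "cost Accept X = 1"
| "cost Reject X = 1"

text \<open>
  \<open>run P c t b\<close>: started in \<open>c\<close>, the program \<open>P\<close> halts at cost \<open>t\<close> with verdict \<open>b\<close>. A run
  that leaves the program text has no verdict.
\<close>

inductive run :: "instr list \<Rightarrow> config \<Rightarrow> nat \<Rightarrow> bool \<Rightarrow> bool" for P where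
  accept: "\<lbrakk>pc < length P; P ! pc = Accept\<rbrakk> \<Longrightarrow> run P (pc, X, w) 1 True"
| reject: "\<lbrakk>pc < length P; P ! pc = Reject\<rbrakk> \<Longrightarrow> run P (pc, X, w) 1 False"
| step: "\<lbrakk>pc < length P; P ! pc \<notin> {Accept, Reject};
          run P (exec (P ! pc) (pc, X, w)) t b\<rbrakk> \<Longrightarrow>
     run P (pc, X, w) (cost (P ! pc) X + t) b"

lemma run_deterministic:
  "run P c t b \<Longrightarrow> run P c t' b' \<Longrightarrow> t = t' \<and> b = b'"
proof (induction arbitrary: t' b' rule: run.induct)
  case (accept pc X w)
  from accept.prems accept.hyps show ?case by (auto elim: run.cases)
next
  case (reject pc X w)
  from reject.prems reject.hyps show ?case by (auto elim: run.cases)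
next
  case (step pc X w t b)
  from step.prems obtain t'' where
    "t' = cost (P ! pc) X + t''" "run P (exec (P ! pc) (pc, X, w)) t'' b'"
    by cases (use step.hyps in auto)
  with step.IH show ?case by blast
qed

text \<open>
  A decision problem is given by its set of instances, their encoding as bit strings, and the
  property to be decided; on all instances the program has to give the right verdict within a
  time polynomial in the length of the encoding.
\<close>

definition polytime_decidable :: "'a set \<Rightarrow> ('a \<Rightarrow> bool list) \<Rightarrow> ('a \<Rightarrow> bool) \<Rightarrow> bool" where
  "polytime_decidable Inst enc Q \<longleftrightarrow>
     (\<exists>(P :: instr list) (p :: nat poly). \<forall>x\<in>Inst. \<exists>t.
        run P (0, (\<lambda>_. 0), enc x) t (Q x) \<and> t \<le> poly p (length (enc x)))"


section \<open>Encoding of instances\<close>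

text \<open>
  Numbers are written in binary and made self-delimiting: every bit is preceded by \<open>True\<close>, and
  \<open>False\<close> marks the end. Sets of machines are written as characteristic vectors.
\<close>

definition enc_nat :: "nat \<Rightarrow> bool list" where
  "enc_nat x = concat (map (\<lambda>b. [True, b]) (binary x)) @ [False]"

definition enc_mset :: "nat \<Rightarrow> nat set \<Rightarrow> bool list" where
  "enc_mset m A = map (\<lambda>i. i \<in> A) [1..<m + 1]"

fun enc_instance :: "open_shop \<times> shop_state \<Rightarrow> bool list" where
  "enc_instance (S, s) =
     enc_nat (njobs S) @ enc_nat (nmach S) @
     concat (map (\<lambda>i. enc_nat (cap S i)) [1..<nmach S + 1]) @
     concat (map (\<lambda>j. enc_mset (nmach S) (mset_of S j) @ enc_nat (loc s j) @
                      enc_mset (nmach S) (todo s j)) [1..<njobs S + 1])"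

end

theory Submission
  imports Defs
begin

text \<open>
  Read backwards in time, a job on its current machine still has to return to all machines that
  it has visited before, and then to machine \<open>0\<close>. A set of jobs is blocking if all machines
  that its members have to return to are filled to capacity by members of the set. Blocking
  sets cannot be dissolved backwards, so they do not occur in reachable states. Conversely, if
  there is none, then some backward move creates none: let \<open>M\<close> be a free machine that some job
  has to return to and suppose that every move to \<open>M\<close> creates a blocking set. Before the move
  such a set is nearly blocking, with \<open>M\<close> as the only machine that is not full. Nearly blocking
  sets are closed under intersections that keep a job heading for \<open>M\<close>, and in a minimal one
  the jobs that sit on machines of interest form a blocking set.

  The largest blocking set is found by repeatedly discarding jobs that have nowhere to return
  to, or may return to a machine that the remaining jobs do not fill.
\<close>

section \<open>Blocking sets\<close>

text \<open>A state records which machines a job has completed but not in which order, and jobs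
  compete for room on the way, so searching for a schedule would range over exponentially many
  orders. Backwards, the obstruction can be read off the present state, and some harmless move
  always exists. The choice of job matters: a job that enters a free machine takes up room there and
  may thereby lock a group of jobs. The free machine itself is found by applying the hypothesis to
  the set of all jobs away from machine 0. As a state may also be impossible because of a single
  job, for example one that has left unfinished, a consistency test joins the criterion. On the
  computing side, cost is charged per bit; a small structured language is compiled to the machine so
  that only its steps need counting. Loops over jobs and machines are polynomial although both
  numbers are coded in binary, because each job and each machine contributes further bits of its
  own.\<close>

definition at_loc :: "'j set \<Rightarrow> ('j \<Rightarrow> nat) \<Rightarrow> nat \<Rightarrow> 'j set" where
  "at_loc J l i = {j\<in>J. l j = i}"

text \<open>\<open>R j\<close> collects the machines that job \<open>j\<close> still has to return
  to. It must be nonempty because a job with nothing left to undo can go straight back to machine 0.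
  Locations and sets are plain functions, so that the situation after a move is another instance, by
  function update.\<close>

definition blocks ::
  "'j set \<Rightarrow> ('j \<Rightarrow> nat) \<Rightarrow> ('j \<Rightarrow> nat set) \<Rightarrow> (nat \<Rightarrow> nat) \<Rightarrow> 'j set \<Rightarrow> bool" where
  "blocks J l R c B \<longleftrightarrow> B \<subseteq> J \<and> B \<noteq> {} \<and>
     (\<forall>j\<in>B. R j \<noteq> {} \<and> (\<forall>i\<in>R j. at_loc J l i \<subseteq> B \<and> card (at_loc J l i) = c i))"

lemma finite_at_loc: "finite J \<Longrightarrow> finite (at_loc J l i)"
  by (simp add: at_loc_def)

lemma unblocking_move:
  assumes fin: "finite J"
    and pos: "\<And>j i. j \<in> J \<Longrightarrow> i \<in> R j \<Longrightarrow> c i > 0"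
    and cap: "\<And>j i. j \<in> J \<Longrightarrow> i \<in> R j \<Longrightarrow> card (at_loc J l i) \<le> c i"
    and out: "\<And>j. j \<in> J \<Longrightarrow> l j \<notin> R j"
    and nb: "\<And>B. \<not> blocks J l R c B"
    and j0: "j0 \<in> J" "M \<in> R j0"
  shows "\<exists>k\<in>J. M \<in> R k \<and> (\<forall>B. \<not> blocks J (l(k := M)) (R(k := R k - {M})) c B)"
proof (rule ccontr)
  assume "\<not> ?thesis"
  then obtain Bk where Bk:
    "\<And>k. k \<in> J \<Longrightarrow> M \<in> R k \<Longrightarrow> blocks J (l(k := M)) (R(k := R k - {M})) c (Bk k)"
    by metis
  \<comment> \<open>After the move \<open>k\<close> sits on \<open>M\<close>, so before it the count
    at \<open>M\<close> was one lower; this is why fullness is waived for \<open>M\<close>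
    only.\<close>
  define near where "near B \<longleftrightarrow> B \<subseteq> J \<and> (\<exists>j\<in>B. M \<in> R j) \<and>
     (\<forall>j\<in>B. R j \<noteq> {} \<and> (\<forall>i\<in>R j. at_loc J l i \<subseteq> B \<and> (i \<noteq> M \<longrightarrow> card (at_loc J l i) = c i)))"
    for B
  have Bk_props: "near (Bk k)" "k \<in> Bk k" "\<And>j. j \<in> Bk k \<Longrightarrow> l k \<notin> R j" "R k \<noteq> {M}"
    if k: "k \<in> J" "M \<in> R k" for k
  proof -
    let ?l = "l(k := M)" and ?R = "R(k := R k - {M})"
    have b: "Bk k \<subseteq> J" "Bk k \<noteq> {}" and
      bR: "\<And>j. j \<in> Bk k \<Longrightarrow> ?R j \<noteq> {}" and
      bs: "\<And>j i. j \<in> Bk k \<Longrightarrow> i \<in> ?R j \<Longrightarrow> at_loc J ?l i \<subseteq> Bk k" and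
      bc: "\<And>j i. j \<in> Bk k \<Longrightarrow> i \<in> ?R j \<Longrightarrow> card (at_loc J ?l i) = c i"
      using Bk[OF k] by (auto simp: blocks_def)
    have RR: "?R j \<subseteq> R j" for j by auto
    have lkM: "l k \<noteq> M" using out k by auto
    have same: "at_loc J ?l i = at_loc J l i" if "i \<noteq> M" "i \<noteq> l k" for i
      using that by (auto simp: at_loc_def)
    have atM: "at_loc J ?l M = insert k (at_loc J l M)" using k by (auto simp: at_loc_def)
    \<comment> \<open>Leaving \<open>l k\<close> brings that machine below its capacity, so no
      member of a blocking set can have to return to it.\<close>
    have away': "i \<noteq> l k" if "j \<in> Bk k" "i \<in> ?R j" for i j
    proof
      assume i: "i = l k"
      have "at_loc J ?l i \<subset> at_loc J l i" using i k lkM by (auto simp: at_loc_def)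
      then have "card (at_loc J ?l i) < card (at_loc J l i)"
        by (rule psubset_card_mono[OF finite_at_loc[OF fin]])
      moreover have "card (at_loc J l i) \<le> c i" using cap[of j i] that b RR by blast
      ultimately show False using bc[OF that] by simp
    qed
    \<comment> \<open>Otherwise the arrival at \<open>M\<close> is irrelevant and
      \<open>Bk k - {k}\<close> blocks already before the move. It is nonempty: a lone
      \<open>k\<close> would need a full machine with no occupant but itself, while it sits on
      \<open>M\<close>, which it no longer needs.\<close>
    have "\<exists>j\<in>Bk k. M \<in> ?R j"
    proof (rule ccontr)
      assume no: "\<not> ?thesis"
      have s: "at_loc J l i = at_loc J ?l i" if "j \<in> Bk k" "i \<in> ?R j" for i j
        using same[of i] no away'[OF that] that by metis
      have "blocks J l R c (Bk k - {k})"
        unfolding blocks_def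
      proof (intro conjI ballI)
        show "Bk k - {k} \<subseteq> J" using b by blast
        show "Bk k - {k} \<noteq> {}"
        proof
          assume "Bk k - {k} = {}"
          then have Bk1: "Bk k = {k}" using b by blast
          then obtain i where i: "i \<in> ?R k" using bR by blast
          then have "at_loc J ?l i \<subseteq> {k}" using bs[of k i] Bk1 by auto
          moreover have "k \<notin> at_loc J ?l i" using i by (auto simp: at_loc_def)
          ultimately have "at_loc J ?l i = {}" by blast
          then have "card (at_loc J ?l i) = 0" by simp
          then show False using bc[of k i] Bk1 i pos[of k i] k by auto
        qed
        fix j assume j: "j \<in> Bk k - {k}"
        then show "R j \<noteq> {}" using bR[of j] by auto
        fix i assume i: "i \<in> R j"
        then have i': "i \<in> ?R j" using j by auto
        have "k \<notin> at_loc J l i" using away'[OF _ i'] j by (auto simp: at_loc_def)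
        then show "at_loc J l i \<subseteq> Bk k - {k}" using s[OF _ i'] bs[OF _ i'] j by auto
        show "card (at_loc J l i) = c i" using s[OF _ i'] bc[OF _ i'] j by auto
      qed
      then show False using nb by blast
    qed
    then obtain jM where jM: "jM \<in> Bk k" "M \<in> ?R jM" by blast
    then have Msub: "insert k (at_loc J l M) \<subseteq> Bk k" using bs[OF jM] atM by simp
    then show kB: "k \<in> Bk k" by blast
    show "near (Bk k)" unfolding near_def
    proof (intro conjI ballI impI)
      show "\<exists>j\<in>Bk k. M \<in> R j" using k kB by blast
      fix j assume j: "j \<in> Bk k"
      show "R j \<noteq> {}" using bR[OF j] RR by blast
      fix i assume i: "i \<in> R j"
      have *: "i \<in> ?R j" if "i \<noteq> M" using i that by auto
      show "at_loc J l i \<subseteq> Bk k"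
        using Msub same[of i] bs[OF j *] away'[OF j *] by (cases "i = M") auto
      show "card (at_loc J l i) = c i" if "i \<noteq> M"
        using that same[of i] bc[OF j *] away'[OF j *] by auto
    qed (use b in auto)
    show "l k \<notin> R j" if "j \<in> Bk k" for j
      using away'[OF that, of "l k"] out k by (cases "j = k") auto
    show "R k \<noteq> {M}" using bR[OF kB] by auto
  qed
  have "near (Bk j0)" using Bk_props j0 by blast
  then obtain B where B: "near B" and min: "\<And>B'. near B' \<Longrightarrow> card B \<le> card B'"
    using ex_has_least_nat[of near "Bk j0" card] by metis
  have BJ: "B \<subseteq> J" using B by (simp add: near_def)
  then have finB: "finite B" using fin finite_subset by blast
  have sub: "B \<subseteq> Bk k" if k: "k \<in> B" "M \<in> R k" for k
  proof -
    have kJ: "k \<in> J" using BJ k by blast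
    \<comment> \<open>\<open>k\<close> lies in both sets and heads for \<open>M\<close>, so the
      intersection keeps a job heading for \<open>M\<close>.\<close>
    have "near (B \<inter> Bk k)"
      using B Bk_props(1,2)[OF kJ k(2)] k unfolding near_def by blast
    then have "card B \<le> card (B \<inter> Bk k)" by (rule min)
    then have "B \<inter> Bk k = B" using finB by (metis card_seteq inf_le1)
    then show ?thesis by blast
  qed
  have noM: "l k \<notin> R j" if "k \<in> B" "M \<in> R k" "j \<in> B" for k j
    using Bk_props(3)[of k j] sub[of k] that BJ by blast
  define C where "C = {k\<in>B. \<exists>j\<in>B. l k \<in> R j}"
  have occ: "at_loc J l i \<subseteq> C" if "j \<in> B" "i \<in> R j" for i j
    using B that unfolding near_def C_def at_loc_def by blast
  have "C = {}"
  proof (rule ccontr)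
    assume "C \<noteq> {}"
    \<comment> \<open>Members of \<open>C\<close> thus return only to machines for which fullness
      was not waived, and by \<open>occ\<close> the occupants of these machines lie in
      \<open>C\<close> again.\<close>
    moreover have "M \<notin> R k" if "k \<in> C" for k using that noM unfolding C_def by blast
    moreover have "C \<subseteq> B" by (auto simp: C_def)
    ultimately have "blocks J l R c C"
      using B BJ occ unfolding blocks_def near_def by (metis subset_eq)
    then show False using nb by blast
  qed
  obtain k where k: "k \<in> B" "M \<in> R k" using B by (auto simp: near_def)
  \<comment> \<open>With \<open>C\<close> empty, all machines wanted inside \<open>B\<close> are
    empty; one other than \<open>M\<close> would also be full, against positive capacity. So
    \<open>k\<close> wants nothing but \<open>M\<close>, which \<open>Bk_props(4)\<close>
    excludes.\<close>
  have "i = M" if "i \<in> R k" for i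
  proof (rule ccontr)
    assume "i \<noteq> M"
    then have "card (at_loc J l i) = c i" using B k that by (auto simp: near_def)
    moreover have "at_loc J l i = {}" using occ[OF k(1) that] \<open>C = {}\<close> by blast
    ultimately show False using pos[of k i] k BJ that by auto
  qed
  then have "R k = {M}" using k by blast
  then show False using Bk_props(4)[of k] k BJ by blast
qed

section \<open>Reachable states\<close>

text \<open>The current machine is left out: the next backward move undoes it, so the job need not
  return there.\<close>

definition visited :: "open_shop \<Rightarrow> shop_state \<Rightarrow> nat \<Rightarrow> nat set" where
  "visited S s j = mset_of S j - todo s j - {loc s j}"

text \<open>Conditions on single jobs that \<open>is_state\<close> leaves open but every schedule
  enforces. What remains is jobs standing in each other's way.\<close>

definition consistent :: "open_shop \<Rightarrow> shop_state \<Rightarrow> bool" where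
  "consistent S s \<longleftrightarrow> (\<forall>j\<in>{1..njobs S}.
     (loc s j = 0 \<longrightarrow> todo s j = mset_of S j) \<and>
     (loc s j = nmach S + 1 \<longrightarrow> todo s j = {}) \<and>
     (loc s j \<in> {1..nmach S} \<longrightarrow> loc s j \<in> mset_of S j))"

abbreviation blocking :: "open_shop \<Rightarrow> shop_state \<Rightarrow> nat set \<Rightarrow> bool" where
  "blocking S s \<equiv> blocks {1..njobs S} (loc s) (visited S s) (cap S)"

lemma load_eq: "load S s i = card (at_loc {1..njobs S} (loc s) i)"
  by (simp add: load_def at_loc_def)

lemma at_loc_upd:
  "at_loc J (l(j := i)) k =
     (if k = i then (if j \<in> J then insert j (at_loc J l k) else at_loc J l k)
      else at_loc J l k - {j})"
  by (auto simp: at_loc_def)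

lemma card_at_loc_minus:
  "finite J \<Longrightarrow> j \<in> J \<Longrightarrow> card (at_loc J l (l j) - {j}) < card (at_loc J l (l j))"
  by (rule psubset_card_mono) (auto simp: at_loc_def)

text \<open>The machines filled by \<open>B\<close> in the primed situation hold members of
  \<open>B\<close> only, hence not \<open>j\<close>. The same jobs stand there in the unprimed one,
  and the capacity bound leaves no room for further ones.\<close>

lemma blocks_unaffected:
  assumes "blocks J l' R' c B" "j \<notin> B" "\<And>k. k \<noteq> j \<Longrightarrow> l' k = l k" "\<And>k. k \<noteq> j \<Longrightarrow> R' k = R k"
    "finite J" "\<And>k i. k \<in> J \<Longrightarrow> i \<in> R k \<Longrightarrow> card (at_loc J l i) \<le> c i"
  shows "blocks J l R c B"
proof -
  have B: "B \<subseteq> J" "B \<noteq> {}" using assms(1) by (auto simp: blocks_def)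
  have "R k \<noteq> {} \<and> (\<forall>i\<in>R k. at_loc J l i \<subseteq> B \<and> card (at_loc J l i) = c i)" if k: "k \<in> B" for k
  proof -
    have eq: "R' k = R k" using assms(2,4) k by metis
    have "at_loc J l i \<subseteq> B \<and> card (at_loc J l i) = c i" if i: "i \<in> R k" for i
    proof -
      have a: "at_loc J l' i \<subseteq> B" "card (at_loc J l' i) = c i"
        using assms(1) k i eq by (auto simp: blocks_def)
      have "x \<in> at_loc J l i" if "x \<in> at_loc J l' i" for x
      proof -
        have "x \<noteq> j" using that a(1) assms(2) by blast
        then show ?thesis using that assms(3)[of x] by (simp add: at_loc_def)
      qed
      then have "at_loc J l' i \<subseteq> at_loc J l i" by blast
      moreover have "card (at_loc J l i) \<le> c i" using assms(6) i k B by blast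
      ultimately have "at_loc J l' i = at_loc J l i"
        using a(2) by (intro card_seteq finite_at_loc assms(5)) auto
      with a show ?thesis by simp
    qed
    moreover have "R k \<noteq> {}" using assms(1) k eq unfolding blocks_def by metis
    ultimately show ?thesis by blast
  qed
  with B show ?thesis by (simp add: blocks_def)
qed

section \<open>Forward moves: invariants of reachable states\<close>

lemma visited_subset: "is_open_shop S \<Longrightarrow> j \<in> {1..njobs S} \<Longrightarrow> visited S s j \<subseteq> {1..nmach S}"
  unfolding visited_def is_open_shop_def by blast

lemma card_at_loc_le_cap:
  assumes "is_open_shop S" "is_state S s" "j \<in> {1..njobs S}" "i \<in> visited S s j"
  shows "card (at_loc {1..njobs S} (loc s) i) \<le> cap S i"
proof -
  have "i \<in> {1..nmach S}" using visited_subset assms by blast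
  then have "load S s i \<le> cap S i" using assms(2) by (simp add: is_state_def)
  then show ?thesis by (simp add: load_eq)
qed

text \<open>If a job arrives from a machine, that machine is afterwards visited but not full, so
  no blocking set contains the job; without it, a blocking set was blocking before.\<close>

lemma successor_invariant:
  assumes S: "is_open_shop S" and st: "is_state S s" and con: "consistent S s"
    and nb: "\<And>B. \<not> blocking S s B" and suc: "successor S s s'"
  shows "is_state S s' \<and> consistent S s' \<and> (\<forall>B. \<not> blocking S s' B)"
  using suc
proof cases
  case (move j i)
  let ?J = "{1..njobs S}"
  have jst: "loc s j \<le> nmach S + 1" "todo s j \<subseteq> mset_of S j - {loc s j}"
    using st move by (auto simp: is_state_def)
  have im: "i \<in> {1..nmach S}" "i \<in> mset_of S j" "i \<noteq> loc s j"
    using S jst move unfolding is_open_shop_def by blast+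
  have ld: "load S s' k \<le> (if k = i then Suc (load S s k) else load S s k)" for k
    using move by (auto simp: load_eq at_loc_upd finite_at_loc card_insert_if
        intro!: card_mono split: if_splits)
  have st': "is_state S s'"
    unfolding is_state_def
  proof (intro conjI ballI allI impI)
    fix k assume "k \<in> {1..nmach S}"
    then have "load S s k \<le> cap S k" using st by (simp add: is_state_def)
    then show "load S s' k \<le> cap S k" using ld[of k] move by (auto split: if_splits)
  qed (use st move im in \<open>auto simp: is_state_def\<close>)
  have con': "consistent S s'"
    using con move im by (auto simp: consistent_def)
  have "\<not> blocking S s' B" for B
  proof
    assume B: "blocking S s' B"
    have "j \<notin> B"
    proof
      assume j: "j \<in> B"
      have v: "visited S s' j = mset_of S j - todo s j"
        using move jst by (auto simp: visited_def)
      have "loc s j \<noteq> nmach S + 1" using con move by (auto simp: consistent_def)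
      \<comment> \<open>A job coming from machine 0 has an empty visited set after the move, which
        membership in \<open>B\<close> excludes.\<close>
      moreover have "loc s j \<noteq> 0"
        using con move B j v by (auto simp: consistent_def blocks_def)
      ultimately have l: "loc s j \<in> {1..nmach S}" using jst by auto
      then have "loc s j \<in> visited S s' j"
        using con move jst v by (auto simp: consistent_def)
      then have "card (at_loc ?J (loc s') (loc s j)) = cap S (loc s j)"
        using B j by (auto simp: blocks_def)
      moreover have "at_loc ?J (loc s') (loc s j) = at_loc ?J (loc s) (loc s j) - {j}"
        using move im by (simp add: at_loc_upd)
      moreover have "card (at_loc ?J (loc s) (loc s j)) \<le> cap S (loc s j)"
        using st l by (simp add: is_state_def load_eq)
      ultimately show False
        using card_at_loc_minus[of ?J j "loc s"] move by simp
    qed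
    from blocks_unaffected[OF B this, of "loc s" "visited S s"] have "blocking S s B"
      using card_at_loc_le_cap[OF S st] move by (auto simp: visited_def)
    then show False using nb by blast
  qed
  with st' con' show ?thesis by blast
next
  case (leave j)
  let ?J = "{1..njobs S}"
  let ?e = "nmach S + 1"
  have jst: "loc s j \<le> nmach S + 1" using st leave by (auto simp: is_state_def)
  have mj: "mset_of S j \<subseteq> {1..nmach S}" using S leave by (auto simp: is_open_shop_def)
  have ld: "load S s' k \<le> load S s k" if "k \<noteq> ?e" for k
    using leave that by (auto simp: load_eq at_loc_upd finite_at_loc intro!: card_mono)
  have st': "is_state S s'"
    unfolding is_state_def
  proof (intro conjI ballI allI impI)
    fix k assume "k \<in> {1..nmach S}"
    then show "load S s' k \<le> cap S k" using st ld[of k] by (force simp: is_state_def)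
  qed (use st leave in \<open>auto simp: is_state_def\<close>)
  have con': "consistent S s'"
    using con leave by (auto simp: consistent_def)
  have "\<not> blocking S s' B" for B
  proof
    assume B: "blocking S s' B"
    have "j \<notin> B"
    proof
      assume j: "j \<in> B"
      have v: "visited S s' j = mset_of S j"
        using leave mj by (auto simp: visited_def)
      have "loc s j \<noteq> 0"
        using con leave B j v by (auto simp: consistent_def blocks_def)
      then have l: "loc s j \<in> {1..nmach S}" using jst leave by auto
      then have "loc s j \<in> visited S s' j"
        using con leave v by (auto simp: consistent_def)
      then have "card (at_loc ?J (loc s') (loc s j)) = cap S (loc s j)"
        using B j by (auto simp: blocks_def)
      moreover have "at_loc ?J (loc s') (loc s j) = at_loc ?J (loc s) (loc s j) - {j}"
        using leave by (simp add: at_loc_upd)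
      moreover have "card (at_loc ?J (loc s) (loc s j)) \<le> cap S (loc s j)"
        using st l by (simp add: is_state_def load_eq)
      ultimately show False
        using card_at_loc_minus[of ?J j "loc s"] leave by simp
    qed
    from blocks_unaffected[OF B this, of "loc s" "visited S s"] have "blocking S s B"
      using card_at_loc_le_cap[OF S st] leave by (auto simp: visited_def)
    then show False using nb by blast
  qed
  with st' con' show ?thesis by blast
qed

lemma reachable_imp:
  assumes S: "is_open_shop S" and "reachable S s"
  shows "is_state S s \<and> consistent S s \<and> (\<forall>B. \<not> blocking S s B)"
  using assms(2) unfolding reachable_def
proof (induction rule: rtranclp_induct)
  case base
  have "load S (initial_state S) i = 0" if "i \<in> {1..nmach S}" for i
    using that by (simp add: load_def initial_state_def)
  moreover have "0 \<notin> mset_of S j" if "j \<in> {1..njobs S}" for j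
    using S that by (fastforce simp: is_open_shop_def)
  moreover have "\<not> blocking S (initial_state S) B" for B
    by (auto simp: blocks_def visited_def initial_state_def subset_eq)
  ultimately show ?case
    by (auto simp: is_state_def consistent_def) (auto simp: initial_state_def)
next
  case (step s s')
  then show ?case using successor_invariant[OF S, of s s'] by blast
qed

section \<open>Backward moves and the criterion for reachability\<close>

text \<open>The number of backward moves left: one for each visited machine, and a last one to
  machine 0 for every job not yet there.\<close>

definition work :: "open_shop \<Rightarrow> shop_state \<Rightarrow> nat" where
  "work S s = (\<Sum>j\<in>{1..njobs S}. card (visited S s j) + of_bool (loc s j \<noteq> 0))"

lemma work_less:
  assumes "j \<in> {1..njobs S}" "\<And>k. k \<noteq> j \<Longrightarrow> loc s' k = loc s k \<and> visited S s' k = visited S s k"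
    "card (visited S s' j) + of_bool (loc s' j \<noteq> 0) < card (visited S s j) + of_bool (loc s j \<noteq> 0)"
  shows "work S s' < work S s"
  unfolding work_def
proof (rule sum_strict_mono_ex1)
  show "\<forall>k\<in>{1..njobs S}. card (visited S s' k) + of_bool (loc s' k \<noteq> 0)
      \<le> card (visited S s k) + of_bool (loc s k \<noteq> 0)"
    using assms(2,3) by (metis order.refl order.strict_implies_order)
  show "\<exists>k\<in>{1..njobs S}. card (visited S s' k) + of_bool (loc s' k \<noteq> 0)
      < card (visited S s k) + of_bool (loc s k \<noteq> 0)"
    using assms(1,3) by blast
qed simp

text \<open>Machine 0 is unbounded, and a job with an empty visited set belongs to no blocking set.
  By \<open>blocks_unaffected\<close> its departure creates none among the others.\<close>

lemma predecessor_to_start: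
  assumes S: "is_open_shop S" and st: "is_state S s" and con: "consistent S s"
    and nb: "\<And>B. \<not> blocking S s B"
    and j: "j \<in> {1..njobs S}" "visited S s j = {}" "loc s j \<noteq> 0"
  shows "\<exists>s'. successor S s' s \<and> is_state S s' \<and> consistent S s' \<and>
     (\<forall>B. \<not> blocking S s' B) \<and> work S s' < work S s"
proof -
  let ?J = "{1..njobs S}"
  define s' where "s' = \<lparr>loc = (loc s)(j := 0), todo = (todo s)(j := mset_of S j)\<rparr>"
  have mj: "mset_of S j \<subseteq> {1..nmach S}" using S j by (auto simp: is_open_shop_def)
  have jst: "loc s j \<le> nmach S + 1" "todo s j \<subseteq> mset_of S j - {loc s j}"
    using st j by (auto simp: is_state_def)
  have ld: "load S s' k \<le> load S s k" if "k \<noteq> 0" for k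
    using that by (auto simp: s'_def load_eq at_loc_upd finite_at_loc intro!: card_mono)
  have vis: "visited S s' k = visited S s k" if "k \<noteq> j" for k
    using that by (auto simp: visited_def s'_def)
  have vj: "visited S s' j = {}" by (auto simp: visited_def s'_def)
  have "successor S s' s"
  proof (cases "loc s j = nmach S + 1")
    case True
    then have t: "todo s j = {}" using con j by (auto simp: consistent_def)
    \<comment> \<open>A job at the end that has visited nothing requires no machine at all, so the
      forward move is \<open>leave\<close> directly from machine 0.\<close>
    then have m: "mset_of S j = {}" using j mj True by (auto simp: visited_def)
    have "s = \<lparr>loc = (loc s')(j := nmach S + 1), todo = todo s'\<rparr>"
      using True t m by (auto simp: s'_def fun_upd_idem)
    then show ?thesis using successor.leave[of j S s'] j m by (auto simp: s'_def)
  next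
    case False
    then have l: "loc s j \<in> {1..nmach S}" using jst j by auto
    then have lm: "loc s j \<in> mset_of S j" using con j by (auto simp: consistent_def)
    have t: "todo s j = mset_of S j - {loc s j}" using j jst by (auto simp: visited_def)
    \<comment> \<open>The forward move enters the machine that \<open>j\<close> has just vacated
      backwards, so there is a place for it.\<close>
    have "load S s' (loc s j) < load S s (loc s j)"
      using j card_at_loc_minus[of ?J j "loc s"] by (simp add: s'_def load_eq at_loc_upd)
    also have "\<dots> \<le> cap S (loc s j)" using st l by (simp add: is_state_def)
    finally have "load S s' (loc s j) < cap S (loc s j)" .
    moreover have "s = \<lparr>loc = (loc s')(j := loc s j),
        todo = (todo s')(j := todo s' j - {loc s j})\<rparr>"
      using t by (auto simp: s'_def fun_upd_idem)
    ultimately show ?thesis using successor.move[of j S "loc s j" s'] j lm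
      by (auto simp: s'_def)
  qed
  moreover have st': "is_state S s'"
    unfolding is_state_def
  proof (intro conjI ballI allI impI)
    fix k assume "k \<in> {1..nmach S}"
    then show "load S s' k \<le> cap S k" using st ld[of k] by (force simp: is_state_def)
  qed (use st mj j in \<open>auto simp: is_state_def s'_def\<close>)
  moreover have "consistent S s'"
    using con by (auto simp: consistent_def s'_def)
  moreover have "\<not> blocking S s' B" for B
  proof
    assume B: "blocking S s' B"
    then have "j \<notin> B" using vj by (auto simp: blocks_def)
    from blocks_unaffected[OF B this, of "loc s" "visited S s"] have "blocking S s B"
      using card_at_loc_le_cap[OF S st] vis by (auto simp: s'_def)
    then show False using nb by blast
  qed
  moreover have "work S s' < work S s"
    by (rule work_less[OF j(1)]) (use vis vj j in \<open>auto simp: s'_def\<close>)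
  ultimately show ?thesis by blast
qed

lemma predecessor_to_machine:
  assumes S: "is_open_shop S" and st: "is_state S s" and con: "consistent S s"
    and j: "j \<in> {1..njobs S}" "i \<in> visited S s j" and free: "load S s i < cap S i"
    and nb: "\<And>B. \<not> blocks {1..njobs S} ((loc s)(j := i))
       ((visited S s)(j := visited S s j - {i})) (cap S) B"
  shows "\<exists>s'. successor S s' s \<and> is_state S s' \<and> consistent S s' \<and>
     (\<forall>B. \<not> blocking S s' B) \<and> work S s' < work S s"
proof -
  let ?J = "{1..njobs S}"
  define s' where "s' = \<lparr>loc = (loc s)(j := i),
     todo = (todo s)(j := todo s j \<union> ({loc s j} \<inter> {1..nmach S}))\<rparr>"
  have mj: "mset_of S j \<subseteq> {1..nmach S}" using S j by (auto simp: is_open_shop_def)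
  have jst: "loc s j \<le> nmach S + 1" "todo s j \<subseteq> mset_of S j - {loc s j}"
    using st j by (auto simp: is_state_def)
  have i: "i \<in> mset_of S j" "i \<notin> todo s j" "i \<noteq> loc s j" "i \<in> {1..nmach S}"
    using j mj by (auto simp: visited_def)
  have l0: "loc s j \<noteq> 0" using con j i by (metis consistent_def)
  have lm: "loc s j \<in> mset_of S j" if "loc s j \<in> {1..nmach S}"
    using con j that by (auto simp: consistent_def)
  have ld: "load S s' k \<le> (if k = i then Suc (load S s k) else load S s k)" for k
    using j by (auto simp: s'_def load_eq at_loc_upd finite_at_loc card_insert_if
        intro!: card_mono split: if_splits)
  have vis: "visited S s' = (visited S s)(j := visited S s j - {i})"
    using mj by (auto simp: visited_def s'_def fun_eq_iff)
  have "successor S s' s"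
  proof (cases "loc s j = nmach S + 1")
    case True
    then have t: "todo s j = {}" using con j by (auto simp: consistent_def)
    have "s = \<lparr>loc = (loc s')(j := nmach S + 1), todo = todo s'\<rparr>"
      using True t by (auto simp: s'_def fun_upd_idem)
    then show ?thesis using successor.leave[of j S s'] j t True i by (auto simp: s'_def)
  next
    case False
    then have l: "loc s j \<in> {1..nmach S}" using jst l0 by auto
    have "load S s' (loc s j) < load S s (loc s j)"
      using j i card_at_loc_minus[of ?J j "loc s"] by (simp add: s'_def load_eq at_loc_upd)
    also have "\<dots> \<le> cap S (loc s j)" using st l by (simp add: is_state_def)
    finally have "load S s' (loc s j) < cap S (loc s j)" .
    moreover have "todo s j \<union> {loc s j} - {loc s j} = todo s j" using jst by auto
    then have "s = \<lparr>loc = (loc s')(j := loc s j),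
        todo = (todo s')(j := todo s' j - {loc s j})\<rparr>"
      using l by (simp add: s'_def fun_upd_idem)
    ultimately show ?thesis using successor.move[of j S "loc s j" s'] j l
      by (auto simp: s'_def)
  qed
  moreover have st': "is_state S s'"
    unfolding is_state_def
  proof (intro conjI ballI allI impI)
    fix k assume "k \<in> {1..nmach S}"
    then have "load S s k \<le> cap S k" using st by (simp add: is_state_def)
    then show "load S s' k \<le> cap S k" using ld[of k] free by (auto split: if_splits)
  next
    fix k assume k: "k \<in> ?J"
    show "loc s' k \<in> {0..nmach S + 1}" using st k i by (auto simp: is_state_def s'_def)
    show "todo s' k \<subseteq> mset_of S k - {loc s' k}"
      using st k i lm jst by (cases "k = j") (auto simp: is_state_def s'_def)
  qed (use st j in \<open>auto simp: is_state_def s'_def\<close>)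
  moreover have "consistent S s'"
    using con i by (auto simp: consistent_def s'_def)
  moreover have "\<not> blocking S s' B" for B
    using nb[of B] by (simp add: vis) (simp add: s'_def)
  moreover have "finite (visited S s j)"
    using visited_subset[OF S j(1)] finite_subset by blast
  then have "card (visited S s j - {i}) < card (visited S s j)"
    using j by (intro psubset_card_mono) auto
  then have "work S s' < work S s"
    by (intro work_less[OF j(1)]) (use vis l0 in \<open>auto simp: s'_def\<close>)
  ultimately show ?thesis by blast
qed

lemma predecessor_ex:
  assumes S: "is_open_shop S" and st: "is_state S s" and con: "consistent S s"
    and nb: "\<And>B. \<not> blocking S s B"
    and j: "j \<in> {1..njobs S}" "loc s j \<noteq> 0"
  shows "\<exists>s'. successor S s' s \<and> is_state S s' \<and> consistent S s' \<and>
     (\<forall>B. \<not> blocking S s' B) \<and> work S s' < work S s"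
proof (cases "\<exists>k\<in>{1..njobs S}. visited S s k = {} \<and> loc s k \<noteq> 0")
  case True
  then show ?thesis using predecessor_to_start[OF S st con nb] by blast
next
  case False
  let ?J = "{1..njobs S}"
  \<comment> \<open>Every member has somewhere to return to, and proper machines are occupied by
    members only. So this set can fail to block only because a machine to which a member has to
    return has room.\<close>
  let ?B = "{k\<in>?J. loc s k \<noteq> 0}"
  have "\<not> blocking S s ?B" by (rule nb)
  then obtain k i where k: "k \<in> ?B" "i \<in> visited S s k"
     "\<not> at_loc ?J (loc s) i \<subseteq> ?B \<or> card (at_loc ?J (loc s) i) \<noteq> cap S i"
    using False j unfolding blocks_def by blast
  have i: "i \<in> {1..nmach S}" using visited_subset[OF S] k by blast
  then have "at_loc ?J (loc s) i \<subseteq> ?B" by (auto simp: at_loc_def)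
  then have free: "card (at_loc ?J (loc s) i) < cap S i"
    using k card_at_loc_le_cap[OF S st, of k i] by auto
  have "\<exists>k\<in>?J. i \<in> visited S s k \<and>
     (\<forall>B. \<not> blocks ?J ((loc s)(k := i)) ((visited S s)(k := visited S s k - {i})) (cap S) B)"
  proof (rule unblocking_move)
    show "0 < cap S i" if "j \<in> ?J" "i \<in> visited S s j" for j i
      using S that visited_subset[OF S that(1), of s] unfolding is_open_shop_def by blast
    show "loc s j \<notin> visited S s j" for j by (auto simp: visited_def)
    show "k \<in> ?J" using k by blast
  qed (use k nb free card_at_loc_le_cap[OF S st] in auto)
  then show ?thesis
    using predecessor_to_machine[OF S st con] free by (auto simp: load_eq)
qed

text \<open>The descent on \<open>work\<close> stops when all jobs are at machine 0. Consistency,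
  together with the fixed values outside the jobs, then forces the initial state.\<close>

theorem reachable_iff:
  assumes S: "is_open_shop S" and st: "is_state S s"
  shows "reachable S s \<longleftrightarrow> consistent S s \<and> (\<forall>B. \<not> blocking S s B)"
proof
  assume "consistent S s \<and> (\<forall>B. \<not> blocking S s B)"
  with st show "reachable S s"
  proof (induction "work S s" arbitrary: s rule: less_induct)
    case less
    show ?case
    proof (cases "\<exists>j\<in>{1..njobs S}. loc s j \<noteq> 0")
      case True
      then obtain s' where s': "successor S s' s" "is_state S s'" "consistent S s'"
        "\<forall>B. \<not> blocking S s' B" "work S s' < work S s"
        using predecessor_ex[OF S] less.prems by blast
      then have "reachable S s'" using less.hyps by blast
      with s'(1) show ?thesis unfolding reachable_def by (meson rtranclp.simps)
    next
      case False
      then have "loc s = (\<lambda>j. 0)"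
        using less.prems(1) by (auto simp: is_state_def fun_eq_iff)
      moreover have "todo s = (\<lambda>j. if j \<in> {1..njobs S} then mset_of S j else {})"
        using less.prems False by (auto simp: is_state_def consistent_def fun_eq_iff)
      ultimately have "s = initial_state S" by (simp add: initial_state_def)
      then show ?thesis by (simp add: reachable_def)
    qed
  qed
qed (use reachable_imp[OF S] in blast)

section \<open>Step counts and logarithmic cost\<close>

inductive steps :: "instr list \<Rightarrow> config \<Rightarrow> nat \<Rightarrow> config \<Rightarrow> bool" for P where
  steps_refl: "steps P c 0 c"
| steps_step: "\<lbrakk>pc < length P; P ! pc \<notin> {Accept, Reject};
     steps P (exec (P ! pc) (pc, X, w)) k c\<rbrakk> \<Longrightarrow> steps P (pc, X, w) (Suc k) c"

lemma steps_trans: "steps P c k c' \<Longrightarrow> steps P c' k' c'' \<Longrightarrow> steps P c (k + k') c''"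
  by (induction rule: steps.induct) (auto intro: steps.intros)

lemma steps_one:
  "pc < length P \<Longrightarrow> P ! pc \<notin> {Accept, Reject} \<Longrightarrow> exec (P ! pc) (pc, X, w) = c
   \<Longrightarrow> steps P (pc, X, w) 1 c"
  using steps_step[OF _ _ steps_refl, of pc P X w] by simp

lemma steps_zero_iff: "steps P c 0 c' \<longleftrightarrow> c = c'"
  by (auto elim: steps.cases intro: steps.intros)

lemma steps_Suc_iff:
  "pc < length P \<Longrightarrow> P ! pc \<notin> {Accept, Reject} \<Longrightarrow>
   steps P (pc, X, w) (Suc k) c \<longleftrightarrow> steps P (exec (P ! pc) (pc, X, w)) k c"
  by (auto elim: steps.cases intro: steps.intros)

lemma length_binary_le: "x < 2 ^ B \<Longrightarrow> length (binary x) \<le> B"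
proof (induction x arbitrary: B rule: binary.induct)
  case (1 x)
  show ?case
  proof (cases "x = 0")
    case False
    then obtain B' where B: "B = Suc B'" using "1.prems" by (cases B) auto
    then have "x div 2 < 2 ^ B'" using "1.prems" by auto
    with "1.IH" False have "length (binary (x div 2)) \<le> B'" by blast
    with False B show ?thesis by (subst binary.simps) auto
  qed (simp add: binary.simps)
qed

lemma bitlen_le: "x < 2 ^ B \<Longrightarrow> bitlen x \<le> Suc B"
  using length_binary_le[of x B] by (simp add: bitlen_def)

text \<open>Bounds the addresses and constants written in the program text. A jump target is neither
  charged nor stored in a register, hence no condition on it.\<close>

fun instr_bound :: "nat \<Rightarrow> instr \<Rightarrow> bool" where
  "instr_bound K (Const i c) \<longleftrightarrow> i < 2 ^ K \<and> c < 2 ^ K"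
| "instr_bound K (Add i j k) \<longleftrightarrow> i < 2 ^ K \<and> j < 2 ^ K \<and> k < 2 ^ K"
| "instr_bound K (Sub i j k) \<longleftrightarrow> i < 2 ^ K \<and> j < 2 ^ K \<and> k < 2 ^ K"
| "instr_bound K (Load i j) \<longleftrightarrow> i < 2 ^ K \<and> j < 2 ^ K"
| "instr_bound K (Store i j) \<longleftrightarrow> i < 2 ^ K \<and> j < 2 ^ K"
| "instr_bound K (Jump j l) \<longleftrightarrow> j < 2 ^ K"
| "instr_bound K (Read i) \<longleftrightarrow> i < 2 ^ K"
| "instr_bound K Accept \<longleftrightarrow> True"
| "instr_bound K Reject \<longleftrightarrow> True"

lemma instr_bound_mono: "instr_bound K ins \<Longrightarrow> K \<le> K' \<Longrightarrow> instr_bound K' ins"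
proof -
  assume *: "instr_bound K ins" "K \<le> K'"
  have "(2::nat) ^ K \<le> 2 ^ K'" using *(2) by (intro power_increasing) auto
  then have "x < 2 ^ K'" if "x < 2 ^ K" for x :: nat
    using that by (rule less_le_trans[rotated])
  with * show ?thesis by (cases ins) auto
qed

lemma instr_bound_ex: "\<exists>K. instr_bound K ins"
proof (cases ins)
  case (Const i c)
  have "i < 2 ^ (i + c)" "c < 2 ^ (i + c)"
    by (meson le_add1 le_add2 le_less_trans less_exp)+
  with Const show ?thesis by auto
next
  case (Add i j k)
  have "i < 2 ^ (i + j + k)" "j < 2 ^ (i + j + k)" "k < 2 ^ (i + j + k)"
    using less_exp[of "i + j + k"] by linarith+
  with Add show ?thesis by auto
next
  case (Sub i j k)
  have "i < 2 ^ (i + j + k)" "j < 2 ^ (i + j + k)" "k < 2 ^ (i + j + k)"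
    using less_exp[of "i + j + k"] by linarith+
  with Sub show ?thesis by auto
next
  case (Load i j)
  have "i < 2 ^ (i + j)" "j < 2 ^ (i + j)" using less_exp[of "i + j"] by linarith+
  with Load show ?thesis by auto
next
  case (Store i j)
  have "i < 2 ^ (i + j)" "j < 2 ^ (i + j)" using less_exp[of "i + j"] by linarith+
  with Store show ?thesis by auto
qed (auto intro: less_exp)

lemma program_bound_ex: "\<exists>K. \<forall>ins\<in>set P. instr_bound K ins"
proof (induction P)
  case (Cons a P)
  then obtain K K' where "\<forall>ins\<in>set P. instr_bound K ins" "instr_bound K' a"
    using instr_bound_ex by blast
  then have "\<forall>ins\<in>set (a # P). instr_bound (max K K') ins"
    using instr_bound_mono by (metis max.cobounded1 max.cobounded2 set_ConsD)
  then show ?case by blast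
qed simp

text \<open>At most five numbers are charged, namely in \<open>Add\<close> and
  \<open>Sub\<close>.\<close>

lemma cost_le:
  assumes "instr_bound B ins" "\<And>r. X r < 2 ^ B"
  shows "cost ins X \<le> 5 * Suc B"
proof -
  have X: "bitlen (X r) \<le> Suc B" for r using bitlen_le[OF assms(2)] .
  show ?thesis
  proof (cases ins)
    case (Const i c)
    with assms(1) bitlen_le[of i B] bitlen_le[of c B] show ?thesis by simp
  next
    case (Add i j k)
    with assms(1) bitlen_le[of i B] bitlen_le[of j B] bitlen_le[of k B] X[of j] X[of k]
    show ?thesis by simp
  next
    case (Sub i j k)
    with assms(1) bitlen_le[of i B] bitlen_le[of j B] bitlen_le[of k B] X[of j] X[of k]
    show ?thesis by simp
  next
    case (Load i j)
    with assms(1) bitlen_le[of i B] bitlen_le[of j B] X[of j] X[of "X j"] show ?thesis by simp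
  next
    case (Store i j)
    with assms(1) bitlen_le[of i B] bitlen_le[of j B] X[of i] X[of j] show ?thesis by simp
  next
    case (Jump j l)
    with assms(1) bitlen_le[of j B] X[of j] show ?thesis by simp
  next
    case (Read i)
    with assms(1) bitlen_le[of i B] show ?thesis by simp
  qed simp_all
qed

text \<open>Doubling comes from \<open>Add\<close>; \<open>B \<ge> 1\<close> accommodates the value
  2 that \<open>Read\<close> delivers at the end of the input.\<close>

lemma exec_bound:
  assumes "instr_bound B ins" "\<And>r. X r < 2 ^ B" "exec ins (pc, X, w) = (pc', X', w')" "B \<ge> 1"
  shows "X' r < 2 ^ Suc B"
proof -
  have B: "(2::nat) \<le> 2 ^ B" using power_increasing[OF assms(4), of "2::nat"] by simp
  have le: "X r < 2 * 2 ^ B" for r using assms(2)[of r] by linarith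
  have "\<And>i j. X i + X j < 2 * 2 ^ B" "\<And>i j. X i - X j < 2 * 2 ^ B"
    using assms(2) by (metis add_strict_mono mult_2) (meson le diff_le_self le_less_trans)
  with assms(1,3) B le show ?thesis
    by (cases ins; cases w) (auto simp: of_bool_def split: if_splits)
qed

text \<open>A single step at most doubles the largest register content, so \<open>k\<close> steps produce numbers
  of \<open>O(k)\<close> bits only: bounding the number of steps is enough.\<close>

lemma steps_run:
  assumes "steps P c k c'" "run P c' 1 b" "c = (pc, X, w)" "\<forall>ins\<in>set P. instr_bound B ins"
    "\<And>r. X r < 2 ^ B" "B \<ge> 1"
  shows "\<exists>t. run P c t b \<and> t \<le> k * (5 * Suc (B + k)) + 1"
  using assms
proof (induction arbitrary: pc X w B rule: steps.induct)
  case (steps_step pc' X' w' k c)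
  then have [simp]: "pc' = pc" "X' = X" "w' = w" by auto
  obtain pc2 X2 w2 where e: "exec (P ! pc) (pc, X, w) = (pc2, X2, w2)"
    by (metis prod_cases3)
  have ins: "instr_bound B (P ! pc)" using steps_step by auto
  have "\<And>r. X2 r < 2 ^ Suc B" using exec_bound[OF ins steps_step.prems(4) e] steps_step.prems by blast
  moreover have "\<forall>ins\<in>set P. instr_bound (Suc B) ins"
    using instr_bound_mono[OF _ le_SucI[OF order_refl]] steps_step.prems(3) by blast
  ultimately obtain t where
    t: "run P (pc2, X2, w2) t b" "t \<le> k * (5 * Suc (Suc B + k)) + 1"
    using steps_step.IH[OF steps_step.prems(1), of pc2 X2 w2 "Suc B"] e by auto
  have "run P (pc, X, w) (cost (P ! pc) X + t) b"
    using run.step[of pc P X w t b] steps_step.hyps e t by auto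
  moreover have "cost (P ! pc) X \<le> 5 * Suc B" using cost_le[OF ins steps_step.prems(4)] .
  ultimately show ?case using t(2) by (intro exI[of _ "cost (P ! pc) X + t"]) auto
qed auto

section \<open>A structured language with arrays\<close>

datatype var = vN | vM | vI | vJ | vR | vK | vB | vP | vL | vOk | vT | vD | vE | vF

datatype arr = Free | Loc | Live | Req

datatype com =
    Skip
  | Set var nat
  | Inc var
  | Plus var var var
  | Minus var var var
  | Get var arr var
  | Put arr var var
  | Input var
  | Seq com com (infixr ";;" 60)
  | Cond var com com
  | Loop var com

type_synonym store = "(var \<Rightarrow> nat) \<times> (arr \<Rightarrow> nat \<Rightarrow> nat) \<times> bool list"

text \<open>\<open>Input\<close> has no rule for an exhausted tape, so a derivation also shows that
  the program never reads beyond the instance.\<close>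

inductive big :: "com \<Rightarrow> store \<Rightarrow> nat \<Rightarrow> store \<Rightarrow> bool" where
  Skip: "big Skip s 1 s"
| Set: "big (Set x c) (V, A, w) 1 (V(x := c), A, w)"
| Inc: "big (Inc x) (V, A, w) 1 (V(x := Suc (V x)), A, w)"
| Plus: "big (Plus x y z) (V, A, w) 1 (V(x := V y + V z), A, w)"
| Minus: "big (Minus x y z) (V, A, w) 1 (V(x := V y - V z), A, w)"
| Get: "big (Get x a y) (V, A, w) 1 (V(x := A a (V y)), A, w)"
| Put: "big (Put a y x) (V, A, w) 1 (V, A(a := (A a)(V y := V x)), w)"
| Input: "big (Input x) (V, A, b # w) 1 (V(x := of_bool b), A, w)"
| Seq: "big c s t s' \<Longrightarrow> big d s' t' s'' \<Longrightarrow> big (c ;; d) s (t + t') s''"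
| Cond_True: "V x > 0 \<Longrightarrow> big c (V, A, w) t s' \<Longrightarrow> big (Cond x c d) (V, A, w) (Suc t) s'"
| Cond_False: "V x = 0 \<Longrightarrow> big d (V, A, w) t s' \<Longrightarrow> big (Cond x c d) (V, A, w) (Suc t) s'"
| Loop_False: "V x = 0 \<Longrightarrow> big (Loop x c) (V, A, w) 1 (V, A, w)"
| Loop_True: "V x > 0 \<Longrightarrow> big c (V, A, w) t s' \<Longrightarrow> big (Loop x c) s' t' s''
     \<Longrightarrow> big (Loop x c) (V, A, w) (Suc (t + t')) s''"

text \<open>Registers \<open>0\<close> and \<open>1\<close> are scratch, registers \<open>2, \<dots>, 15\<close> hold the variables, and the
  arrays are interleaved with stride \<open>16\<close> from register \<open>16\<close> on, so that addresses are
  computed by four doublings.\<close>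

fun reg :: "var \<Rightarrow> nat" where
  "reg vN = 2" | "reg vM = 3" | "reg vI = 4" | "reg vJ = 5" | "reg vR = 6" | "reg vK = 7"
| "reg vB = 8" | "reg vP = 9" | "reg vL = 10" | "reg vOk = 11" | "reg vT = 12" | "reg vD = 13"
| "reg vE = 14" | "reg vF = 15"

fun arr_index :: "arr \<Rightarrow> nat" where
  "arr_index Free = 0" | "arr_index Loc = 1" | "arr_index Live = 2" | "arr_index Req = 3"

definition addr :: "arr \<Rightarrow> nat \<Rightarrow> nat" where
  "addr a i = 16 * Suc i + arr_index a"

lemma reg_bounds: "2 \<le> reg x" "reg x < 16"
  by (cases x; simp)+

lemma reg_eq_iff [simp]: "reg x = reg y \<longleftrightarrow> x = y"
  by (cases x; cases y; simp)

lemma reg_neq [simp]: "reg x \<noteq> 0" "reg x \<noteq> Suc 0" "0 \<noteq> reg x" "Suc 0 \<noteq> reg x"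
  using reg_bounds[of x] by linarith+

lemma addr_ge: "addr a i \<ge> 16" by (simp add: addr_def)

lemma addr_neq [simp]: "addr a i \<noteq> 0" "addr a i \<noteq> Suc 0" "addr a i \<noteq> reg x" "reg x \<noteq> addr a i"
  using addr_ge[of a i] reg_bounds[of x] by linarith+

lemma addr_eq_iff [simp]: "addr a i = addr b j \<longleftrightarrow> a = b \<and> i = j"
proof
  assume *: "addr a i = addr b j"
  have "arr_index c < 16" for c by (cases c) auto
  then have "addr c k mod 16 = arr_index c" for c k
    by (simp add: addr_def del: mult_Suc_right)
  then have "arr_index a = arr_index b" using * by metis
  moreover from this have "a = b" by (cases a; cases b) auto
  ultimately show "a = b \<and> i = j" using * by (simp add: addr_def)
qed simp

section \<open>Translation into machine code\<close>

definition addr_code :: "arr \<Rightarrow> var \<Rightarrow> instr list" where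
  "addr_code a y =
     [Const 0 1, Add 0 0 (reg y), Add 0 0 0, Add 0 0 0, Add 0 0 0, Add 0 0 0,
      Const 1 (arr_index a), Add 0 0 1]"

fun size_of :: "com \<Rightarrow> nat" where
  "size_of Skip = 0"
| "size_of (Set x c) = 1"
| "size_of (Inc x) = 2"
| "size_of (Plus x y z) = 1"
| "size_of (Minus x y z) = 1"
| "size_of (Get x a y) = 9"
| "size_of (Put a y x) = 9"
| "size_of (Input x) = 1"
| "size_of (c ;; d) = size_of c + size_of d"
| "size_of (Cond x c d) = size_of c + size_of d + 3"
| "size_of (Loop x c) = size_of c + 5"

text \<open>Jump targets are absolute, hence the start address \<open>p\<close>; forward targets use
  \<open>size_of\<close>, which does not depend on it. An unconditional jump is a jump on register 0
  after setting it to 1. In \<open>Cond\<close> the code of the else branch comes first, because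
  \<open>Jump\<close> is taken on positive values.\<close>

fun compile :: "com \<Rightarrow> nat \<Rightarrow> instr list" where
  "compile Skip p = []"
| "compile (Set x c) p = [Const (reg x) c]"
| "compile (Inc x) p = [Const 0 1, Add (reg x) (reg x) 0]"
| "compile (Plus x y z) p = [Add (reg x) (reg y) (reg z)]"
| "compile (Minus x y z) p = [Sub (reg x) (reg y) (reg z)]"
| "compile (Get x a y) p = addr_code a y @ [Load (reg x) 0]"
| "compile (Put a y x) p = addr_code a y @ [Store 0 (reg x)]"
| "compile (Input x) p = [Read (reg x)]"
| "compile (c ;; d) p = compile c p @ compile d (p + size_of c)"
| "compile (Cond x c d) p =
     [Jump (reg x) (p + size_of d + 3)] @ compile d (p + 1) @
     [Const 0 1, Jump 0 (p + size_of d + 3 + size_of c)] @ compile c (p + size_of d + 3)"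
| "compile (Loop x c) p =
     [Jump (reg x) (p + 3), Const 0 1, Jump 0 (p + size_of c + 5)] @ compile c (p + 3) @
     [Const 0 1, Jump 0 p]"

lemma length_compile [simp]: "length (compile c p) = size_of c"
  by (induction c arbitrary: p) (auto simp: addr_code_def)

fun code_at :: "instr list \<Rightarrow> nat \<Rightarrow> instr list \<Rightarrow> bool" where
  "code_at P p [] \<longleftrightarrow> True"
| "code_at P p (i # is) \<longleftrightarrow> p < length P \<and> P ! p = i \<and> code_at P (Suc p) is"

lemma code_at_append [simp]:
  "code_at P p (xs @ ys) \<longleftrightarrow> code_at P p xs \<and> code_at P (p + length xs) ys"
  by (induction xs arbitrary: p) auto

lemma code_at_self: "code_at (xs @ ys @ zs) (length xs) ys"
  by (induction ys arbitrary: xs) (simp, metis append.assoc append_Cons append_Nil code_at.simps(2)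
      length_append_singleton nth_append_length length_append length_Cons less_add_same_cancel1 zero_less_Suc)

text \<open>The passage from registers to a store forgets registers 0 and 1, so scratch writes need
  no invariant in the simulation.\<close>

definition vars_of :: "(nat \<Rightarrow> nat) \<Rightarrow> var \<Rightarrow> nat" where
  "vars_of X = (\<lambda>v. X (reg v))"

definition arrs_of :: "(nat \<Rightarrow> nat) \<Rightarrow> arr \<Rightarrow> nat \<Rightarrow> nat" where
  "arrs_of X = (\<lambda>a i. X (addr a i))"

lemma vars_of_simps [simp]:
  "vars_of (X(0 := c)) = vars_of X" "vars_of (X(Suc 0 := c)) = vars_of X"
  "vars_of (X(reg x := c)) = (vars_of X)(x := c)" "vars_of (X(addr a i := c)) = vars_of X"
  by (auto simp: vars_of_def fun_eq_iff)

lemma arrs_of_simps [simp]: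
  "arrs_of (X(0 := c)) = arrs_of X" "arrs_of (X(Suc 0 := c)) = arrs_of X"
  "arrs_of (X(reg x := c)) = arrs_of X"
  "arrs_of (X(addr a i := c)) = (arrs_of X)(a := (arrs_of X a)(i := c))"
  by (auto simp: arrs_of_def fun_eq_iff)

lemma steps_addr_code:
  assumes "code_at P p (addr_code a y)"
  shows "\<exists>X'. steps P (p, X, w) 8 (p + 8, X', w) \<and> vars_of X' = vars_of X \<and>
     arrs_of X' = arrs_of X \<and> X' 0 = addr a (X (reg y))"
proof -
  let ?a = "Suc (X (reg y))"
  let ?X = "X(0 := 1, 0 := ?a, 0 := 2 * ?a, 0 := 4 * ?a, 0 := 8 * ?a, 0 := 16 * ?a,
     Suc 0 := arr_index a, 0 := addr a (X (reg y)))"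
  have "steps P (p, X, w) 8 (p + 8, ?X, w)"
    using assms
    by (simp add: addr_code_def addr_def steps_Suc_iff steps_zero_iff eval_nat_numeral
        fun_eq_iff)
  moreover have "vars_of ?X = vars_of X" "arrs_of ?X = arrs_of X" by simp_all
  moreover have "?X 0 = addr a (X (reg y))" by simp
  ultimately show ?thesis by (intro exI[of _ ?X]) simp
qed

lemma simulationI:
  assumes "steps P c k (p', X', w')" "k \<le> T" "s' = (vars_of X', arrs_of X', w')"
  shows "\<exists>X' k w'. steps P c k (p', X', w') \<and> k \<le> T \<and> s' = (vars_of X', arrs_of X', w')"
  using assms by blast

text \<open>The factor 10 covers the nine instructions of an array access and the at most three
  control instructions that a test or a loop round adds to its body.\<close>

theorem compile_correct:
  assumes "big c s t s'" "code_at P p (compile c p)" "s = (vars_of X, arrs_of X, w)"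
  shows "\<exists>X' k w'. steps P (p, X, w) k (p + size_of c, X', w') \<and> k \<le> 10 * t \<and>
     s' = (vars_of X', arrs_of X', w')"
  using assms
proof (induction arbitrary: p X w rule: big.induct)
  case (Skip s)
  show ?case using Skip steps_refl[of P "(p, X, w)"] by auto
next
  case (Set x c V A w')
  have "steps P (p, X, w) 1 (p + 1, X(reg x := c), w)"
    by (rule steps_one) (use Set in auto)
  then have "steps P (p, X, w) 1 (p + size_of (Set x c), X(reg x := c), w)" by simp
  then show ?case by (rule simulationI) (use Set in auto)
next
  case (Inc x V A w')
  have "steps P (p, X, w) (1 + 1) (p + size_of (Inc x), X(0 := 1, reg x := Suc (X (reg x))), w)"
    by (rule steps_trans; rule steps_one) (use Inc in auto)
  then show ?case by (rule simulationI) (use Inc in \<open>auto simp: vars_of_def[of X]\<close>)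
next
  case (Plus x y z V A w')
  have "steps P (p, X, w) 1 (p + size_of (Plus x y z), X(reg x := X (reg y) + X (reg z)), w)"
    by (rule steps_one) (use Plus in auto)
  then show ?case by (rule simulationI) (use Plus in \<open>auto simp: vars_of_def[of X]\<close>)
next
  case (Minus x y z V A w')
  have "steps P (p, X, w) 1 (p + size_of (Minus x y z), X(reg x := X (reg y) - X (reg z)), w)"
    by (rule steps_one) (use Minus in auto)
  then show ?case by (rule simulationI) (use Minus in \<open>auto simp: vars_of_def[of X]\<close>)
next
  case (Get x a y V A w')
  then obtain X1 where X1: "steps P (p, X, w) 8 (p + 8, X1, w)" "vars_of X1 = vars_of X"
     "arrs_of X1 = arrs_of X" "X1 0 = addr a (X (reg y))"
    using steps_addr_code[of P p a y X w] by auto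
  have "steps P (p + 8, X1, w) 1 (p + 9, X1(reg x := X1 (X1 0)), w)"
    by (rule steps_one) (use Get in \<open>auto simp: addr_code_def eval_nat_numeral\<close>)
  from steps_trans[OF X1(1) this]
  have *: "steps P (p, X, w) 9 (p + size_of (Get x a y), X1(reg x := X1 (X1 0)), w)" by simp
  have "X1 (X1 0) = arrs_of X a (vars_of X y)"
    using X1(4) X1(3)[symmetric] by (simp add: arrs_of_def vars_of_def)
  then show ?case by (intro simulationI[OF *]) (use Get X1 in auto)
next
  case (Put a y x V A w')
  then obtain X1 where X1: "steps P (p, X, w) 8 (p + 8, X1, w)" "vars_of X1 = vars_of X"
     "arrs_of X1 = arrs_of X" "X1 0 = addr a (X (reg y))"
    using steps_addr_code[of P p a y X w] by auto
  have "steps P (p + 8, X1, w) 1 (p + 9, X1(X1 0 := X1 (reg x)), w)"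
    by (rule steps_one) (use Put in \<open>auto simp: addr_code_def eval_nat_numeral\<close>)
  from steps_trans[OF X1(1) this]
  have *: "steps P (p, X, w) 9 (p + size_of (Put a y x), X1(X1 0 := X1 (reg x)), w)" by simp
  have "X1 (reg x) = vars_of X x" "X (reg y) = vars_of X y"
    using X1(2) by (metis vars_of_def)+
  then show ?case by (intro simulationI[OF *]) (use Put X1 in auto)
next
  case (Input x V A b w')
  have "steps P (p, X, w) 1 (p + size_of (Input x), X(reg x := of_bool b), w')"
    by (rule steps_one) (use Input in auto)
  then show ?case by (rule simulationI) (use Input in auto)
next
  case (Seq c s t s' d t' s'')
  then obtain X1 k1 w1 where 1: "steps P (p, X, w) k1 (p + size_of c, X1, w1)" "k1 \<le> 10 * t"
     "s' = (vars_of X1, arrs_of X1, w1)"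
    by (metis code_at_append compile.simps(9))
  with Seq obtain X2 k2 w2 where
     2: "steps P (p + size_of c, X1, w1) k2 (p + size_of c + size_of d, X2, w2)" "k2 \<le> 10 * t'"
     "s'' = (vars_of X2, arrs_of X2, w2)"
    by (metis code_at_append compile.simps(9) length_compile)
  from steps_trans[OF 1(1) 2(1)]
  have "steps P (p, X, w) (k1 + k2) (p + size_of (c ;; d), X2, w2)" by (simp add: add.assoc)
  then show ?case by (rule simulationI) (use 1 2 in auto)
next
  case (Cond_True V x c A w' t s' d)
  then have "X (reg x) > 0" by (auto simp: vars_of_def)
  then have 1: "steps P (p, X, w) 1 (p + size_of d + 3, X, w)"
    by (intro steps_one) (use Cond_True.prems in auto)
  have "code_at P (p + size_of d + 3) (compile c (p + size_of d + 3))"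
    using Cond_True.prems(1) by (simp add: ac_simps numeral_3_eq_3)
  from Cond_True.IH[OF this Cond_True.prems(2)] obtain X2 k2 w2 where
     2: "steps P (p + size_of d + 3, X, w) k2 (p + size_of d + 3 + size_of c, X2, w2)"
     "k2 \<le> 10 * t" "s' = (vars_of X2, arrs_of X2, w2)" by blast
  from steps_trans[OF 1 2(1)]
  have "steps P (p, X, w) (1 + k2) (p + size_of (Cond x c d), X2, w2)" by (simp add: ac_simps)
  then show ?case by (rule simulationI) (use 2 in auto)
next
  case (Cond_False V x d A w' t s' c)
  then have "X (reg x) = 0" by (auto simp: vars_of_def)
  then have 1: "steps P (p, X, w) 1 (p + 1, X, w)"
    by (intro steps_one) (use Cond_False.prems in auto)
  have "code_at P (p + 1) (compile d (p + 1))"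
    using Cond_False.prems(1) by simp
  from Cond_False.IH[OF this Cond_False.prems(2)] obtain X2 k2 w2 where
     2: "steps P (p + 1, X, w) k2 (p + 1 + size_of d, X2, w2)"
     "k2 \<le> 10 * t" "s' = (vars_of X2, arrs_of X2, w2)" by blast
  have 3: "steps P (p + 1 + size_of d, X2, w2) (1 + 1)
      (p + size_of d + 3 + size_of c, X2(0 := 1), w2)"
    by (rule steps_trans; rule steps_one) (use Cond_False.prems in auto)
  from steps_trans[OF 1 steps_trans[OF 2(1) 3]]
  have "steps P (p, X, w) (1 + (k2 + (1 + 1))) (p + size_of (Cond x c d), X2(0 := 1), w2)"
    by (simp add: ac_simps)
  then show ?case by (rule simulationI) (use 2 in auto)
next
  case (Loop_False V x c A w')
  then have "X (reg x) = 0" by (auto simp: vars_of_def)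
  then have 1: "steps P (p, X, w) 1 (p + 1, X, w)"
    by (intro steps_one) (use Loop_False.prems in auto)
  have 2: "steps P (p + 1, X, w) (1 + 1) (p + size_of c + 5, X(0 := 1), w)"
    by (rule steps_trans; rule steps_one) (use Loop_False.prems in auto)
  from steps_trans[OF 1 2]
  have "steps P (p, X, w) (1 + (1 + 1)) (p + size_of (Loop x c), X(0 := 1), w)"
    by (simp add: ac_simps)
  then show ?case by (rule simulationI) (use Loop_False in auto)
next
  case (Loop_True V x c A w' t s' t' s'')
  then have "X (reg x) > 0" by (auto simp: vars_of_def)
  then have 1: "steps P (p, X, w) 1 (p + 3, X, w)"
    by (intro steps_one) (use Loop_True.prems in auto)
  have "code_at P (p + 3) (compile c (p + 3))"
    using Loop_True.prems(1) by (simp add: numeral_3_eq_3)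
  from Loop_True.IH(1)[OF this Loop_True.prems(2)] obtain X2 k2 w2 where
     2: "steps P (p + 3, X, w) k2 (p + 3 + size_of c, X2, w2)"
     "k2 \<le> 10 * t" "s' = (vars_of X2, arrs_of X2, w2)" by blast
  have 3: "steps P (p + 3 + size_of c, X2, w2) (1 + 1) (p, X2(0 := 1), w2)"
    by (rule steps_trans; rule steps_one)
      (use Loop_True.prems in \<open>auto simp: numeral_3_eq_3 ac_simps\<close>)
  have "s' = (vars_of (X2(0 := 1)), arrs_of (X2(0 := 1)), w2)" using 2 by simp
  from Loop_True.IH(2)[OF Loop_True.prems(1) this] obtain X4 k4 w4 where
     4: "steps P (p, X2(0 := 1), w2) k4 (p + size_of (Loop x c), X4, w4)"
     "k4 \<le> 10 * t'" "s'' = (vars_of X4, arrs_of X4, w4)" by blast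
  from steps_trans[OF 1 steps_trans[OF 2(1) steps_trans[OF 3 4(1)]]]
  show ?case by (rule simulationI) (use 2 4 in auto)
qed

section \<open>Weakest preconditions with step counts\<close>

text \<open>Total correctness: a terminating run is asserted and its step count is handed to the
  postcondition, so that result and running time are proved together.\<close>

definition wp :: "com \<Rightarrow> (nat \<Rightarrow> (var \<Rightarrow> nat) \<Rightarrow> (arr \<Rightarrow> nat \<Rightarrow> nat) \<Rightarrow> bool list \<Rightarrow> bool) \<Rightarrow>
    (var \<Rightarrow> nat) \<Rightarrow> (arr \<Rightarrow> nat \<Rightarrow> nat) \<Rightarrow> bool list \<Rightarrow> bool" where
  "wp c Q V A w \<longleftrightarrow> (\<exists>t V' A' w'. big c (V, A, w) t (V', A', w') \<and> Q t V' A' w')"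

lemma wp_mono:
  "wp c Q V A w \<Longrightarrow> (\<And>t V A w. Q t V A w \<Longrightarrow> Q' t V A w) \<Longrightarrow> wp c Q' V A w"
  unfolding wp_def by blast

inductive_simps big_simps:
  "big Skip s t s'"
  "big (Set x k) (V, A, w) t s'"
  "big (Inc x) (V, A, w) t s'"
  "big (Plus x y z) (V, A, w) t s'"
  "big (Minus x y z) (V, A, w) t s'"
  "big (Get x a y) (V, A, w) t s'"
  "big (Put a y x) (V, A, w) t s'"
  "big (Input x) (V, A, b # w) t s'"
  "big (c ;; d) s t s'"
  "big (Cond x c d) (V, A, w) t s'"

lemma wp_simps:
  "wp Skip Q V A w = Q 1 V A w"
  "wp (Set x k) Q V A w = Q 1 (V(x := k)) A w"
  "wp (Inc x) Q V A w = Q 1 (V(x := Suc (V x))) A w"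
  "wp (Plus x y z) Q V A w = Q 1 (V(x := V y + V z)) A w"
  "wp (Minus x y z) Q V A w = Q 1 (V(x := V y - V z)) A w"
  "wp (Get x a y) Q V A w = Q 1 (V(x := A a (V y))) A w"
  "wp (Put a y x) Q V A w = Q 1 V (A(a := (A a)(V y := V x))) w"
  "wp (Input x) Q V A (b # w) = Q 1 (V(x := of_bool b)) A w"
  "wp (c ;; d) Q V A w = wp c (\<lambda>t. wp d (\<lambda>t'. Q (t + t'))) V A w"
  "wp (Cond x c d) Q V A w =
     (if V x > 0 then wp c (\<lambda>t. Q (Suc t)) V A w else wp d (\<lambda>t. Q (Suc t)) V A w)"
  by (simp_all add: wp_def big_simps) blast+

lemmas wp_Set = wp_simps(2)
lemmas wp_Seq = wp_simps(9)

lemma wp_Loop_exit: "V x = 0 \<Longrightarrow> Q 1 V A w \<Longrightarrow> wp (Loop x c) Q V A w"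
  unfolding wp_def using big.Loop_False by blast

lemma wp_Loop_enter:
  assumes "V x > 0" "wp c (\<lambda>t. wp (Loop x c) (\<lambda>t'. Q (Suc (t + t')))) V A w"
  shows "wp (Loop x c) Q V A w"
proof -
  obtain t V' A' w' t' V'' A'' w'' where
    "big c (V, A, w) t (V', A', w')" "big (Loop x c) (V', A', w') t' (V'', A'', w'')"
    "Q (Suc (t + t')) V'' A'' w''"
    using assms(2) unfolding wp_def by blast
  then show ?thesis unfolding wp_def using big.Loop_True[of V x, OF assms(1)] by blast
qed

section \<open>Counting loops and frame conditions\<close>

text \<open>The body sees the indices \<open>1, ..., n\<close>. The test variable \<open>vK\<close>
  is recomputed from \<open>n\<close> and \<open>i\<close> after every round, so nested loops may
  share it.\<close>

definition For :: "var \<Rightarrow> var \<Rightarrow> com \<Rightarrow> com" where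
  "For i n c = Set i 0 ;; Minus vK n i ;; Loop vK (Inc i ;; c ;; Minus vK n i)"

text \<open>Each round adds increment, subtraction and loop test to the time \<open>T\<close> of the
  body; the final 3 pays for the two initial assignments and the failing test. The invariant must
  ignore \<open>i\<close> and \<open>vK\<close>, which the loop itself overwrites.\<close>

lemma wp_For:
  assumes ne: "i \<noteq> vK" "n \<noteq> vK" "i \<noteq> n"
    and I_i: "\<And>a V A w x. I a V A w \<Longrightarrow> I a (V(i := x)) A w"
    and I_K: "\<And>a V A w x. I a V A w \<Longrightarrow> I a (V(vK := x)) A w"
    and body: "\<And>a V A w. a < N \<Longrightarrow> I a V A w \<Longrightarrow> V i = Suc a \<Longrightarrow> V n = N \<Longrightarrow>
      wp c (\<lambda>t V' A' w'. t \<le> T \<and> V' i = Suc a \<and> V' n = N \<and> I (Suc a) V' A' w') V A w"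
    and init: "I 0 V A w" "V n = N"
  shows "wp (For i n c) (\<lambda>t V' A' w'. t \<le> N * (T + 3) + 3 \<and> V' n = N \<and> I N V' A' w') V A w"
proof -
  have loop: "wp (Loop vK (Inc i ;; c ;; Minus vK n i))
      (\<lambda>t V' A' w'. t \<le> k * (T + 3) + 1 \<and> V' n = N \<and> I N V' A' w') V A w"
    if "k + a = N" "I a V A w" "V i = a" "V n = N" "V vK = k" for k a V A w
    using that
  proof (induction k arbitrary: a V A w)
    case 0
    then show ?case by (intro wp_Loop_exit) auto
  next
    case (Suc k)
    have "wp c (\<lambda>t V' A' w'. t \<le> T \<and> V' i = Suc a \<and> V' n = N \<and> I (Suc a) V' A' w')
        (V(i := Suc a)) A w"
      by (rule body) (use Suc.prems ne I_i in auto)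
    then have "wp (Inc i ;; c ;; Minus vK n i) (\<lambda>t V' A' w'. t \<le> T + 2 \<and> V' i = Suc a \<and>
        V' n = N \<and> V' vK = N - Suc a \<and> I (Suc a) V' A' w') V A w"
      unfolding wp_simps Suc.prems(3) by (elim wp_mono) (use ne I_K in auto)
    then have "wp (Inc i ;; c ;; Minus vK n i) (\<lambda>t. wp (Loop vK (Inc i ;; c ;; Minus vK n i))
        (\<lambda>t' V' A' w'. Suc (t + t') \<le> Suc k * (T + 3) + 1 \<and> V' n = N \<and> I N V' A' w')) V A w"
    proof (rule wp_mono, goal_cases)
      case (1 t V' A' w')
      then have "wp (Loop vK (Inc i ;; c ;; Minus vK n i))
        (\<lambda>t V' A' w'. t \<le> k * (T + 3) + 1 \<and> V' n = N \<and> I N V' A' w') V' A' w'"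
        by (intro Suc.IH[of "Suc a"]) (use Suc.prems(1) in auto)
      then show ?case by (rule wp_mono) (use 1 in auto)
    qed
    then show ?case by (rule wp_Loop_enter[rotated]) (use Suc.prems in simp)
  qed
  have "wp (Loop vK (Inc i ;; c ;; Minus vK n i))
      (\<lambda>t V' A' w'. t \<le> N * (T + 3) + 1 \<and> V' n = N \<and> I N V' A' w') (V(i := 0, vK := N)) A w"
    by (rule loop[of N 0]) (use init ne I_i I_K in auto)
  then show ?thesis
    unfolding For_def wp_simps using init(2) ne by (auto elim!: wp_mono)
qed

text \<open>A frame condition: \<open>X\<close> lists the variables that may have changed.\<close>

definition agree :: "var set \<Rightarrow> (var \<Rightarrow> nat) \<Rightarrow> (var \<Rightarrow> nat) \<Rightarrow> bool" where
  "agree X V V' \<longleftrightarrow> (\<forall>v. v \<notin> X \<longrightarrow> V' v = V v)"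

lemma agree_refl [simp]: "agree X V V"
  by (simp add: agree_def)

lemma agree_upd [simp]: "x \<in> X \<Longrightarrow> agree X V (V'(x := c)) \<longleftrightarrow> agree X V V'"
  by (auto simp: agree_def)

lemma agree_trans: "agree X V V' \<Longrightarrow> agree Y V' V'' \<Longrightarrow> X \<subseteq> Z \<Longrightarrow> Y \<subseteq> Z \<Longrightarrow> agree Z V V''"
  by (metis agree_def subset_iff)

section \<open>Reading the instance\<close>

text \<open>\<open>vB\<close> receives the continuation marks and \<open>vD\<close> the digits. The
  most significant digit comes first, so the value is built by Horner's rule.\<close>

definition read_nat :: "var \<Rightarrow> com" where
  "read_nat x = Set x 0 ;; Input vB ;;
     Loop vB (Input vD ;; Plus x x x ;; Plus x x vD ;; Input vB)"

lemma foldl_binary: "foldl (\<lambda>a b. 2 * a + of_bool b) 0 (binary v) = v"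
proof (induction v rule: binary.induct)
  case (1 v)
  then show ?case by (cases "v = 0") (subst binary.simps, auto simp: binary.simps[of 0])+
qed

text \<open>Only an upper bound \<open>L\<close> on the code length enters the time, because
  \<open>wp_For\<close> needs one bound for all rounds.\<close>

lemma wp_read_nat:
  assumes "x \<notin> {vB, vD}" "length (enc_nat v) \<le> L"
  shows "wp (read_nat x) (\<lambda>t V' A' w'. t \<le> 5 * L + 5 \<and> V' x = v \<and> agree {x, vB, vD} V V' \<and>
     A' = A \<and> w' = w) V A (enc_nat v @ w)"
proof -
  let ?c = "Input vD ;; Plus x x x ;; Plus x x vD ;; Input vB"
  have loop: "wp (Input vB ;; Loop vB ?c) (\<lambda>t V' A' w'. t \<le> 5 * length bs + 2 \<and>
      V' x = foldl (\<lambda>a b. 2 * a + of_bool b) (V x) bs \<and> agree {x, vB, vD} V V' \<and> A' = A \<and> w' = w)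
      V A (concat (map (\<lambda>b. [True, b]) bs) @ False # w)" for bs V
  proof (induction bs arbitrary: V)
    case Nil
    show ?case unfolding wp_simps list.map concat.simps append.simps
      by (rule wp_Loop_exit) (use assms(1) in auto)
  next
    case (Cons b bs)
    let ?V = "V(vB := 1, vD := of_bool b, x := 2 * V x + of_bool b)"
    have "wp (Input vB ;; Loop vB ?c) (\<lambda>t V' A' w'. t + 5 \<le> 5 * length (b # bs) + 2 \<and>
      V' x = foldl (\<lambda>a b. 2 * a + of_bool b) (V x) (b # bs) \<and> agree {x, vB, vD} V V' \<and>
      A' = A \<and> w' = w) ?V A (concat (map (\<lambda>b. [True, b]) bs) @ False # w)"
      by (rule wp_mono[OF Cons]) (auto simp: agree_def)
    then have "wp ?c (\<lambda>t. wp (Loop vB ?c) (\<lambda>t' V' A' w'. Suc (1 + (t + t')) \<le>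
      5 * length (b # bs) + 2 \<and> V' x = foldl (\<lambda>a b. 2 * a + of_bool b) (V x) (b # bs) \<and>
      agree {x, vB, vD} V V' \<and> A' = A \<and> w' = w)) (V(vB := 1)) A
      (b # concat (map (\<lambda>b. [True, b]) bs) @ False # w)"
      using assms(1) by (auto simp: wp_simps mult_2 elim!: wp_mono)
    then have "wp (Loop vB ?c) (\<lambda>t V' A' w'. 1 + t \<le> 5 * length (b # bs) + 2 \<and>
      V' x = foldl (\<lambda>a b. 2 * a + of_bool b) (V x) (b # bs) \<and>
      agree {x, vB, vD} V V' \<and> A' = A \<and> w' = w) (V(vB := 1)) A
      (b # concat (map (\<lambda>b. [True, b]) bs) @ False # w)"
      by (intro wp_Loop_enter) (auto elim!: wp_mono)
    then show ?case by (simp add: wp_simps)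
  qed
  have len: "length (enc_nat v) = 2 * length (binary v) + 1"
    unfolding enc_nat_def by (simp add: length_concat o_def sum_list_triv)
  have "wp (Input vB ;; Loop vB ?c) (\<lambda>t V' A' w'. t + 1 \<le> 5 * L + 5 \<and> V' x = v \<and>
     agree {x, vB, vD} V V' \<and> A' = A \<and> w' = w) (V(x := 0)) A (enc_nat v @ w)"
    unfolding enc_nat_def append.assoc append.simps
    by (rule wp_mono[OF loop])
      (use len assms in \<open>auto simp: foldl_binary agree_def\<close>)
  then show ?thesis unfolding read_nat_def wp_Set wp_Seq[of "Set x 0"]
    by (rule wp_mono) auto
qed

definition read_caps :: com where
  "read_caps = For vI vM (read_nat vT ;; Put Free vI vT)"

lemma wp_read_caps:
  assumes "V vM = m" "\<And>i. i \<in> {1..m} \<Longrightarrow> length (enc_nat (f i)) \<le> L"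
  shows "wp read_caps (\<lambda>t V' A' w'. t \<le> m * (9 + 5 * L) + 3 \<and>
     agree {vI, vK, vT, vB, vD} V V' \<and> (\<forall>i\<in>{1..m}. A' Free i = f i) \<and> w' = w)
     V A (concat (map (\<lambda>i. enc_nat (f i)) [1..<m + 1]) @ w)"
proof -
  let ?X = "{vI, vK, vT, vB, vD}"
  let ?I = "\<lambda>a V' A' w'. agree ?X V V' \<and> (\<forall>i\<in>{1..a}. A' Free i = f i) \<and>
     w' = concat (map (\<lambda>i. enc_nat (f i)) [a + 1..<m + 1]) @ w"
  have "wp (For vI vM (read_nat vT ;; Put Free vI vT))
     (\<lambda>t V' A' w'. t \<le> m * (5 * L + 6 + 3) + 3 \<and> V' vM = m \<and> ?I m V' A' w')
     V A (concat (map (\<lambda>i. enc_nat (f i)) [1..<m + 1]) @ w)"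
  proof (rule wp_For[where I = ?I], goal_cases)
    case (6 a V' A' w')
    have w': "w' = enc_nat (f (Suc a)) @
        (concat (map (\<lambda>i. enc_nat (f i)) [Suc a + 1..<m + 1]) @ w)"
      using 6 by (simp add: upt_conv_Cons del: upt_Suc)
    have "length (enc_nat (f (Suc a))) \<le> L" using 6 by (intro assms(2)) auto
    then show ?case
      unfolding w' wp_Seq
      by (intro wp_mono[OF wp_read_nat[where L = L]])
        (use 6 in \<open>auto simp: wp_simps agree_def le_Suc_eq\<close>)
  qed (use assms in auto)
  then show ?thesis unfolding read_caps_def by (rule wp_mono) auto
qed


text \<open>\<open>vP\<close> runs through \<open>Req\<close> across all jobs; the machine has no
  multiplication, and this avoids computing the start of a row.\<close>

definition read_mset :: com where
  "read_mset = For vI vM (Input vB ;; Inc vP ;; Put Req vP vB)"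

lemma wp_read_mset:
  assumes "V vM = m" "V vP = p"
  shows "wp read_mset (\<lambda>t V' A' w'. t \<le> m * 6 + 3 \<and>
     agree {vI, vK, vB, vP} V V' \<and> V' vP = p + m \<and>
     A' = A(Req := \<lambda>k. if p < k \<and> k \<le> p + m then of_bool (k - p \<in> X) else A Req k) \<and> w' = w)
     V A (enc_mset m X @ w)"
proof -
  let ?I = "\<lambda>a V' A' w'. agree {vI, vK, vB, vP} V V' \<and> V' vP = p + a \<and>
     A' = A(Req := \<lambda>k. if p < k \<and> k \<le> p + a then of_bool (k - p \<in> X) else A Req k) \<and>
     w' = map (\<lambda>i. i \<in> X) [a + 1..<m + 1] @ w"
  have "wp (For vI vM (Input vB ;; Inc vP ;; Put Req vP vB))
     (\<lambda>t V' A' w'. t \<le> m * (3 + 3) + 3 \<and> V' vM = m \<and> ?I m V' A' w')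
     V A (enc_mset m X @ w)"
  proof (rule wp_For[where I = ?I], goal_cases)
    case (6 a V' A' w')
    have w': "w' = (Suc a \<in> X) # (map (\<lambda>i. i \<in> X) [Suc a + 1..<m + 1] @ w)"
      using 6 by (simp add: upt_conv_Cons del: upt_Suc)
    show ?case unfolding w' using 6
      by (auto simp: wp_simps fun_eq_iff le_Suc_eq simp del: upt_Suc)
  qed (use assms in \<open>auto simp: enc_mset_def fun_eq_iff\<close>)
  then show ?thesis unfolding read_mset_def by (rule wp_mono) auto
qed

definition bit_ok :: "nat \<Rightarrow> nat set \<Rightarrow> nat set \<Rightarrow> nat \<Rightarrow> nat \<Rightarrow> bool" where
  "bit_ok m X Y l i \<longleftrightarrow>
     (l = 0 \<longrightarrow> i \<in> X \<longrightarrow> i \<in> Y) \<and> (l = m + 1 \<longrightarrow> i \<notin> Y) \<and> (l = i \<longrightarrow> i \<in> X)"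

definition read_todo :: com where
  "read_todo = For vI vM (
     Input vB ;; Inc vP ;; Get vT Req vP ;; Minus vT vT vB ;;
     Minus vD vI vL ;; Minus vE vL vI ;; Plus vD vD vE ;;
     Cond vD
       (Put Req vP vT ;; Cond vT (Cond vL Skip (Set vOk 0)) Skip)
       (Cond vT Skip (Set vOk 0) ;; Set vT 0 ;; Put Req vP vT) ;;
     Cond vB (Minus vE vL vM ;; Cond vE (Set vOk 0) Skip) Skip)"

lemma wp_read_todo:
  assumes "V vM = m" "V vP = p" "V vL = l" "V vOk = of_bool ok" "Y \<subseteq> X - {l}" "l \<le> m + 1"
    "\<And>k. p < k \<Longrightarrow> k \<le> p + m \<Longrightarrow> A Req k = of_bool (k - p \<in> X)"
  shows "wp read_todo (\<lambda>t V' A' w'. t \<le> m * 23 + 3 \<and>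
     agree {vI, vK, vB, vP, vT, vD, vE, vOk} V V' \<and> V' vP = p + m \<and>
     V' vOk = of_bool (ok \<and> (\<forall>i\<in>{1..m}. bit_ok m X Y l i)) \<and>
     A' = A(Req := \<lambda>k. if p < k \<and> k \<le> p + m then of_bool (k - p \<in> X - Y - {l}) else A Req k) \<and>
     w' = w)
     V A (enc_mset m Y @ w)"
proof -
  let ?I = "\<lambda>a V' A' w'. agree {vI, vK, vB, vP, vT, vD, vE, vOk} V V' \<and> V' vP = p + a \<and>
     V' vOk = of_bool (ok \<and> (\<forall>i\<in>{1..a}. bit_ok m X Y l i)) \<and>
     A' = A(Req := \<lambda>k. if p < k \<and> k \<le> p + a then of_bool (k - p \<in> X - Y - {l}) else A Req k) \<and>
     w' = map (\<lambda>i. i \<in> Y) [a + 1..<m + 1] @ w"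
  have "wp read_todo
     (\<lambda>t V' A' w'. t \<le> m * (20 + 3) + 3 \<and> V' vM = m \<and> ?I m V' A' w')
     V A (enc_mset m Y @ w)"
    unfolding read_todo_def
  proof (rule wp_For[where I = ?I], goal_cases)
    case (6 a V' A' w')
    have w': "w' = (Suc a \<in> Y) # (map (\<lambda>i. i \<in> Y) [Suc a + 1..<m + 1] @ w)"
      using 6 by (simp add: upt_conv_Cons del: upt_Suc)
    have A': "A' = A(Req := \<lambda>k. if p < k \<and> k \<le> p + a then of_bool (k - p \<in> X - Y - {l})
        else A Req k)" using 6 by blast
    have r: "A Req (Suc (p + a)) = of_bool (Suc a \<in> X)" using assms(7)[of "Suc (p + a)"] 6 by simp
    have ok: "(\<forall>i\<in>{1..Suc a}. bit_ok m X Y l i) \<longleftrightarrow>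
        (\<forall>i\<in>{1..a}. bit_ok m X Y l i) \<and> bit_ok m X Y l (Suc a)"
      by (auto simp: atLeastAtMostSuc_conv)
    have v: "V' vM = m" "V' vP = p + a" "V' vL = l" "V' vI = Suc a" using 6 assms by (auto simp: agree_def)
    have upd: "(\<lambda>k. if p < k \<and> k \<le> p + a then of_bool (k - p \<in> X - Y - {l}) else A Req k)
        (Suc (p + a) := of_bool (Suc a \<in> X - Y - {l})) =
        (\<lambda>k. if p < k \<and> k \<le> p + Suc a then of_bool (k - p \<in> X - Y - {l}) else A Req k)"
      by (auto simp: fun_eq_iff le_Suc_eq)
    have E: "of_bool (Suc a \<in> X) - of_bool (Suc a \<in> Y) = (of_bool (Suc a \<in> X - Y) :: nat)"
      using assms(5) by auto
    have D: "Suc a - l + (l - Suc a) = 0 \<longleftrightarrow> l = Suc a" by auto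
    show ?case unfolding w' A' ok upd[symmetric] using 6(2) assms(5,6)
      by (simp add: wp_simps v r E D del: upt_Suc)
        (auto simp: bit_ok_def v r simp del: upt_Suc)
  qed (use assms in \<open>auto simp: enc_mset_def fun_eq_iff\<close>)
  then show ?thesis by (rule wp_mono) auto
qed

text \<open>\<open>Req\<close> holds the visited sets row by row. The entries of \<open>Free\<close> for the artificial machines
  are junk and never consulted, as these machines are never in a visited set.\<close>

definition memory :: "open_shop \<Rightarrow> shop_state \<Rightarrow> nat \<Rightarrow> nat set \<Rightarrow> (arr \<Rightarrow> nat \<Rightarrow> nat) \<Rightarrow> bool" where
  "memory S s a D A \<longleftrightarrow> D \<subseteq> {1..a} \<and>
     (\<forall>j\<in>{1..a}. A Loc j = loc s j \<and> A Live j = of_bool (j \<in> D) \<and>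
        (\<forall>i\<in>{1..nmach S}. A Req ((j - 1) * nmach S + i) = of_bool (i \<in> visited S s j))) \<and>
     (\<forall>i\<in>{1..nmach S}. A Free i + card (at_loc D (loc s) i) = cap S i)"

definition job_ok :: "open_shop \<Rightarrow> shop_state \<Rightarrow> nat \<Rightarrow> bool" where
  "job_ok S s j \<longleftrightarrow>
     (\<forall>i\<in>{1..nmach S}. bit_ok (nmach S) (mset_of S j) (todo s j) (loc s j) i)"

text \<open>The tests range over proper machines only; this sees everything because the sets of a
  job contain no others.\<close>

lemma consistent_iff:
  assumes "is_open_shop S" "is_state S s"
  shows "consistent S s \<longleftrightarrow> (\<forall>j\<in>{1..njobs S}. job_ok S s j)"
proof -
  have "job_ok S s j \<longleftrightarrow> (loc s j = 0 \<longrightarrow> todo s j = mset_of S j) \<and>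
     (loc s j = nmach S + 1 \<longrightarrow> todo s j = {}) \<and>
     (loc s j \<in> {1..nmach S} \<longrightarrow> loc s j \<in> mset_of S j)" if "j \<in> {1..njobs S}" for j
  proof -
    have "mset_of S j \<subseteq> {1..nmach S}" "todo s j \<subseteq> mset_of S j"
      using assms that unfolding is_open_shop_def is_state_def by blast+
    then show ?thesis unfolding job_ok_def bit_ok_def by blast
  qed
  then show ?thesis by (simp add: consistent_def)
qed

definition enc_job :: "open_shop \<Rightarrow> shop_state \<Rightarrow> nat \<Rightarrow> bool list" where
  "enc_job S s j = enc_mset (nmach S) (mset_of S j) @ enc_nat (loc s j) @
     enc_mset (nmach S) (todo s j)"

definition read_job :: com where
  "read_job = read_mset ;; read_nat vL ;; Put Loc vJ vL ;; Set vE 1 ;; Put Live vJ vE ;;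
     Get vT Free vL ;; Minus vT vT vE ;; Put Free vL vT ;; Minus vP vP vM ;; read_todo"

lemma job_index_le:
  fixes j a m i :: nat
  assumes "j \<in> {1..a}" "i \<le> m"
  shows "(j - 1) * m + i \<le> a * m"
proof -
  have "(j - 1) * m + i \<le> (j - 1) * m + m" using assms by simp
  also have "\<dots> = j * m" using assms by (cases j) auto
  also have "\<dots> \<le> a * m" using assms by simp
  finally show ?thesis .
qed

lemma at_loc_atLeastAtMost_Suc:
  "at_loc {1..Suc a} l i =
     (if l (Suc a) = i then insert (Suc a) (at_loc {1..a} l i) else at_loc {1..a} l i)"
  by (auto simp: at_loc_def le_Suc_eq)

lemma wp_read_job:
  assumes st: "is_state S s" and a: "a < njobs S"
    and L: "length (enc_nat (loc s (Suc a))) \<le> L"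
    and V: "V vM = nmach S" "V vP = a * nmach S" "V vJ = Suc a"
      "V vOk = of_bool (\<forall>j\<in>{1..a}. job_ok S s j)"
    and A: "memory S s a {1..a} A"
  shows "wp read_job (\<lambda>t V' A' w'. t \<le> nmach S * 29 + 5 * L + 19 \<and>
     agree {vI, vK, vB, vP, vT, vD, vE, vL, vOk} V V' \<and> V' vP = Suc a * nmach S \<and>
     V' vOk = of_bool (\<forall>j\<in>{1..Suc a}. job_ok S s j) \<and>
     memory S s (Suc a) {1..Suc a} A' \<and> w' = w)
     V A (enc_job S s (Suc a) @ w)"
proof -
  let ?m = "nmach S" and ?j = "Suc a"
  let ?p = "a * ?m"
  have jst: "loc s ?j \<le> ?m + 1" "todo s ?j \<subseteq> mset_of S ?j - {loc s ?j}"
    using st a by (auto simp: is_state_def)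
  define A1 where "A1 = A(Req := \<lambda>k. if ?p < k \<and> k \<le> ?p + ?m then
     of_bool (k - ?p \<in> mset_of S ?j) else A Req k)"
  define A2 where "A2 = A1(Loc := (A1 Loc)(?j := loc s ?j), Live := (A1 Live)(?j := 1),
     Free := (A1 Free)(loc s ?j := A1 Free (loc s ?j) - 1))"
  define A3 where "A3 = A2(Req := \<lambda>k. if ?p < k \<and> k \<le> ?p + ?m then
     of_bool (k - ?p \<in> mset_of S ?j - todo s ?j - {loc s ?j}) else A2 Req k)"
  have "memory S s (Suc a) {1..Suc a} A3"
    unfolding memory_def
  proof (intro conjI ballI)
    fix j assume j: "j \<in> {1..Suc a}"
    show "A3 Loc j = loc s j" "A3 Live j = of_bool (j \<in> {1..Suc a})"
      using j A by (auto simp: A3_def A2_def A1_def memory_def le_Suc_eq)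
    fix i assume i: "i \<in> {1..?m}"
    show "A3 Req ((j - 1) * ?m + i) = of_bool (i \<in> visited S s j)"
    proof (cases "j = Suc a")
      case True
      then show ?thesis using i by (simp add: A3_def visited_def)
    next
      case False
      then have j': "j \<in> {1..a}" using j by auto
      with i have "(j - 1) * ?m + i \<le> ?p" using job_index_le[of j a i ?m] by simp
      then have "A3 Req ((j - 1) * ?m + i) = A Req ((j - 1) * ?m + i)"
        by (simp add: A3_def A2_def A1_def)
      also have "\<dots> = of_bool (i \<in> visited S s j)" using A i j' by (auto simp: memory_def)
      finally show ?thesis .
    qed
  next
    fix i assume i: "i \<in> {1..?m}"
    have fr: "A Free i + card (at_loc {1..a} (loc s) i) = cap S i"
      using A i by (auto simp: memory_def)
    \<comment> \<open>\<open>Free\<close> is decremented by truncated subtraction. The capacity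
      bound for the whole state guarantees that an entry of a proper machine is positive when this
      happens.\<close>
    have "at_loc {1..Suc a} (loc s) i \<subseteq> at_loc {1..njobs S} (loc s) i"
      using a by (auto simp: at_loc_def)
    then have "card (at_loc {1..Suc a} (loc s) i) \<le> card (at_loc {1..njobs S} (loc s) i)"
      by (intro card_mono finite_at_loc) auto
    also have "\<dots> \<le> cap S i" using st i by (simp add: is_state_def load_eq)
    finally have le: "card (at_loc {1..Suc a} (loc s) i) \<le> cap S i" .
    have "?j \<notin> at_loc {1..a} (loc s) i" by (simp add: at_loc_def)
    then have "card (at_loc {1..Suc a} (loc s) i) =
        card (at_loc {1..a} (loc s) i) + of_bool (loc s ?j = i)"
      unfolding at_loc_atLeastAtMost_Suc by (simp add: finite_at_loc)
    then show "A3 Free i + card (at_loc {1..Suc a} (loc s) i) = cap S i"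
      using fr le by (auto simp: A3_def A2_def A1_def)
  qed simp
  moreover have "(\<forall>j\<in>{1..Suc a}. job_ok S s j) \<longleftrightarrow>
     (\<forall>j\<in>{1..a}. job_ok S s j) \<and> job_ok S s (Suc a)"
    by (auto simp: atLeastAtMostSuc_conv)
  ultimately have todo: "wp read_todo (\<lambda>t V' A' w'. t \<le> ?m * 23 + 3 \<and>
     agree {vI, vK, vB, vP, vT, vD, vE, vOk} V2 V' \<and> V' vP = Suc a * ?m \<and>
     V' vOk = of_bool (\<forall>j\<in>{1..Suc a}. job_ok S s j) \<and>
     memory S s (Suc a) {1..Suc a} A' \<and> w' = w) V2 A2 (enc_mset ?m (todo s ?j) @ w)"
    if "V2 vM = ?m" "V2 vP = ?p" "V2 vL = loc s ?j"
      "V2 vOk = of_bool (\<forall>j\<in>{1..a}. job_ok S s j)" for V2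
    by (intro wp_mono[OF wp_read_todo[where X = "mset_of S ?j" and l = "loc s ?j", OF that]])
      (use jst in \<open>auto simp: A3_def A2_def A1_def job_ok_def\<close>)
  have tail: "wp (Put Loc vJ vL ;; Set vE 1 ;; Put Live vJ vE ;; Get vT Free vL ;;
       Minus vT vT vE ;; Put Free vL vT ;; Minus vP vP vM ;; read_todo)
     (\<lambda>t V' A' w'. t \<le> ?m * 23 + 10 \<and>
     agree {vI, vK, vB, vP, vT, vD, vE, vOk} V1 V' \<and> V' vP = Suc a * ?m \<and>
     V' vOk = of_bool (\<forall>j\<in>{1..Suc a}. job_ok S s j) \<and>
     memory S s (Suc a) {1..Suc a} A' \<and> w' = w) V1 A1 (enc_mset ?m (todo s ?j) @ w)"
    if V1: "V1 vM = ?m" "V1 vP = ?p + ?m" "V1 vL = loc s ?j" "V1 vJ = Suc a"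
      "V1 vOk = of_bool (\<forall>j\<in>{1..a}. job_ok S s j)" for V1
  proof -
    let ?V2 = "V1(vE := 1, vT := A1 Free (loc s ?j) - 1, vP := ?p)"
    have "wp read_todo (\<lambda>t V' A' w'. t \<le> ?m * 23 + 3 \<and>
       agree {vI, vK, vB, vP, vT, vD, vE, vOk} ?V2 V' \<and> V' vP = Suc a * ?m \<and>
       V' vOk = of_bool (\<forall>j\<in>{1..Suc a}. job_ok S s j) \<and>
       memory S s (Suc a) {1..Suc a} A' \<and> w' = w) ?V2 A2 (enc_mset ?m (todo s ?j) @ w)"
      by (rule todo) (use V1 in auto)
    then have "wp read_todo (\<lambda>t V' A' w'. 7 + t \<le> ?m * 23 + 10 \<and>
       agree {vI, vK, vB, vP, vT, vD, vE, vOk} V1 V' \<and> V' vP = Suc a * ?m \<and>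
       V' vOk = of_bool (\<forall>j\<in>{1..Suc a}. job_ok S s j) \<and>
       memory S s (Suc a) {1..Suc a} A' \<and> w' = w) ?V2 A2 (enc_mset ?m (todo s ?j) @ w)"
      by (rule wp_mono) (auto simp: agree_def)
    then show ?thesis by (simp add: wp_simps V1 A2_def)
  qed
  show ?thesis
    unfolding read_job_def enc_job_def append.assoc wp_Seq[of read_mset] wp_Seq[of "read_nat vL"]
  proof (rule wp_mono[OF wp_read_mset[OF V(1,2)]], goal_cases)
    case (1 t V0 A0 w0)
    then have *: "A0 = A1" "w0 = enc_nat (loc s ?j) @ (enc_mset ?m (todo s ?j) @ w)"
      by (simp_all add: A1_def)
    show ?case unfolding *
    proof (rule wp_mono[OF wp_read_nat[OF _ L]], goal_cases)
      case (2 t' V1 A1' w1)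
      then have *: "A1' = A1" "w1 = enc_mset ?m (todo s ?j) @ w" by blast+
      show ?case unfolding *
        by (rule wp_mono[OF tail]) (use 1 2 V in \<open>auto simp: agree_def\<close>)
    qed simp
  qed
qed

definition read_jobs :: com where
  "read_jobs = For vJ vN read_job"

lemma wp_read_jobs:
  assumes S: "is_open_shop S" and st: "is_state S s"
    and L: "\<And>j. j \<in> {1..njobs S} \<Longrightarrow> length (enc_nat (loc s j)) \<le> L"
    and V: "V vN = njobs S" "V vM = nmach S" "V vP = 0" "V vOk = 1"
    and A: "\<And>i. i \<in> {1..nmach S} \<Longrightarrow> A Free i = cap S i"
  shows "wp read_jobs (\<lambda>t V' A' w'. t \<le> njobs S * (nmach S * 29 + 5 * L + 19 + 3) + 3 \<and>
     V' vN = njobs S \<and> V' vM = nmach S \<and> V' vOk = of_bool (consistent S s) \<and>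
     memory S s (njobs S) {1..njobs S} A') V A (concat (map (enc_job S s) [1..<njobs S + 1]))"
proof -
  let ?n = "njobs S" and ?m = "nmach S"
  let ?I = "\<lambda>a V' A' w'. V' vM = ?m \<and> V' vP = a * ?m \<and>
     V' vOk = of_bool (\<forall>j\<in>{1..a}. job_ok S s j) \<and> memory S s a {1..a} A' \<and>
     w' = concat (map (enc_job S s) [a + 1..<?n + 1])"
  have "wp read_jobs (\<lambda>t V' A' w'. t \<le> ?n * (?m * 29 + 5 * L + 19 + 3) + 3 \<and> V' vN = ?n \<and>
     ?I ?n V' A' w') V A (concat (map (enc_job S s) [1..<?n + 1]))"
    unfolding read_jobs_def
  proof (rule wp_For[where I = ?I], goal_cases)
    case (6 a V' A' w')
    have w': "w' = enc_job S s (Suc a) @ concat (map (enc_job S s) [Suc a + 1..<?n + 1])"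
      using 6 by (simp add: upt_conv_Cons del: upt_Suc)
    have "length (enc_nat (loc s (Suc a))) \<le> L" using 6 by (intro L) auto
    then show ?case unfolding w'
      by (intro wp_mono[OF wp_read_job[OF st, of a L V']])
        (use 6 in \<open>auto simp: agree_def simp del: upt_Suc\<close>)
  qed (use V A in \<open>auto simp: memory_def at_loc_def\<close>)
  then show ?thesis
    by (rule wp_mono) (use consistent_iff[OF S st] in auto)
qed

section \<open>Pruning\<close>

text \<open>Only members of \<open>D\<close> are counted. In a state no proper machine is overfull,
  so a machine filled by \<open>D\<close> holds no other job, and the condition on occupants in
  \<open>blocks\<close> comes for free.\<close>

definition stuck :: "open_shop \<Rightarrow> shop_state \<Rightarrow> nat set \<Rightarrow> nat \<Rightarrow> bool" where
  "stuck S s D j \<longleftrightarrow> visited S s j \<noteq> {} \<and>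
     (\<forall>i\<in>visited S s j. card (at_loc D (loc s) i) = cap S i)"

definition visit :: "open_shop \<Rightarrow> shop_state \<Rightarrow> nat \<Rightarrow> nat set \<Rightarrow> nat set" where
  "visit S s j D = (if stuck S s D j then D else D - {j})"

definition sweep :: "open_shop \<Rightarrow> shop_state \<Rightarrow> nat \<Rightarrow> nat set \<Rightarrow> nat set" where
  "sweep S s a D = fold (visit S s) [1..<a + 1] D"

lemma sweep_Suc: "sweep S s (Suc a) D = visit S s (Suc a) (sweep S s a D)"
  by (simp add: sweep_def)

lemma sweep_0: "sweep S s 0 D = D"
  by (simp add: sweep_def)

lemma visit_subset: "visit S s j D \<subseteq> D"
  by (auto simp: visit_def)

lemma sweep_subset: "sweep S s a D \<subseteq> D"
  by (induction a) (use visit_subset in \<open>force simp: sweep_Suc sweep_0\<close>)+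

lemma sweep_mono: "a \<le> b \<Longrightarrow> sweep S s b D \<subseteq> sweep S s a D"
  by (induction b rule: dec_induct) (use visit_subset in \<open>force simp: sweep_Suc\<close>)+

text \<open>Intermediate sets shrink, so if the whole sweep removes nothing, every job was tested
  against \<open>D\<close> itself.\<close>

lemma sweep_fixpoint:
  assumes "sweep S s n D = D" "j \<in> D" "j \<in> {1..n}"
  shows "stuck S s D j"
proof -
  obtain a where j: "j = Suc a" "Suc a \<le> n" using assms(3) by (cases j) auto
  have "sweep S s b D = D" if "b \<le> n" for b
    using sweep_mono[OF that, of S s D] sweep_subset[of S s b D] assms(1) by blast
  then have "visit S s j D = D" using sweep_Suc[of S s a D] j by simp
  then show ?thesis using assms(2) by (auto simp: visit_def split: if_splits)
qed

lemma sweeps_subset: "(sweep S s n ^^ r) D \<subseteq> D"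
  by (induction r) (use sweep_subset in force)+

text \<open>Every sweep before stabilisation removes a job. After \<open>card D\<close> sweeps
  without stabilisation the set is empty, and that is a fixpoint too.\<close>

lemma sweeps_fixpoint:
  assumes "finite D" "card D \<le> r"
  shows "sweep S s n ((sweep S s n ^^ r) D) = (sweep S s n ^^ r) D"
proof -
  let ?f = "sweep S s n"
  have fin: "finite ((?f ^^ k) D)" for k using sweeps_subset assms(1) finite_subset by metis
  have *: "?f ((?f ^^ k) D) = (?f ^^ k) D \<or> card ((?f ^^ k) D) + k \<le> card D" for k
  proof (induction k)
    case (Suc k)
    show ?case
    proof (cases "?f ((?f ^^ k) D) = (?f ^^ k) D")
      case False
      then have "?f ((?f ^^ k) D) \<subset> (?f ^^ k) D" using sweep_subset by blast
      then have "card (?f ((?f ^^ k) D)) < card ((?f ^^ k) D)" by (rule psubset_card_mono[OF fin])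
      then show ?thesis using Suc False by simp
    qed simp
  qed simp
  have "?f ((?f ^^ r) D) = (?f ^^ r) D \<or> card ((?f ^^ r) D) = 0"
    using assms(2) *[of r] by linarith
  then show ?thesis using fin[of r] sweep_subset[of S s n "(?f ^^ r) D"] by auto
qed

text \<open>The machines wanted by a member of \<open>B\<close> are filled by jobs of
  \<open>B\<close>, all of which are still in \<open>D\<close>; so the member is stuck and
  survives.\<close>

lemma blocking_visit:
  assumes "blocking S s B" "B \<subseteq> D" "D \<subseteq> {1..njobs S}"
  shows "B \<subseteq> visit S s j D"
proof (cases "j \<in> B")
  case True
  have "card (at_loc D (loc s) i) = cap S i" if "i \<in> visited S s j" for i
  proof -
    have "at_loc {1..njobs S} (loc s) i \<subseteq> B" "card (at_loc {1..njobs S} (loc s) i) = cap S i"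
      using assms(1) True that by (auto simp: blocks_def)
    moreover from this have "at_loc D (loc s) i = at_loc {1..njobs S} (loc s) i"
      using assms(2,3) by (auto simp: at_loc_def)
    ultimately show ?thesis by simp
  qed
  moreover have "visited S s j \<noteq> {}" using assms(1) True by (auto simp: blocks_def)
  ultimately have "stuck S s D j" by (simp add: stuck_def)
  with assms show ?thesis by (simp add: visit_def)
qed (use assms in \<open>auto simp: visit_def\<close>)

lemma blocking_sweep:
  assumes "blocking S s B" "B \<subseteq> D" "D \<subseteq> {1..njobs S}"
  shows "B \<subseteq> sweep S s a D"
proof (induction a)
  case (Suc a)
  then show ?case unfolding sweep_Suc
    by (intro blocking_visit assms(1)) (use assms(3) sweep_subset in blast)+
qed (use assms in \<open>simp add: sweep_0\<close>)

text \<open>The final set contains every blocking set, and being a fixpoint it blocks itself unless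
  it is empty.\<close>

lemma sweeps_empty_iff:
  assumes S: "is_open_shop S" and st: "is_state S s"
  shows "(sweep S s (njobs S) ^^ njobs S) {1..njobs S} = {} \<longleftrightarrow> (\<forall>B. \<not> blocking S s B)"
proof -
  let ?f = "sweep S s (njobs S)" and ?J = "{1..njobs S}"
  define D where "D = (?f ^^ njobs S) ?J"
  have DJ: "D \<subseteq> ?J" unfolding D_def by (rule sweeps_subset)
  have fix_D: "?f D = D" unfolding D_def by (rule sweeps_fixpoint) auto
  have "blocking S s D" if "D \<noteq> {}"
    unfolding blocks_def
  proof (intro conjI ballI)
    fix j assume j: "j \<in> D"
    then have st_j: "stuck S s D j" using sweep_fixpoint[OF fix_D] DJ by blast
    then show "visited S s j \<noteq> {}" by (simp add: stuck_def)
    fix i assume i: "i \<in> visited S s j"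
    then have c: "card (at_loc D (loc s) i) = cap S i" using st_j by (simp add: stuck_def)
    have "at_loc D (loc s) i \<subseteq> at_loc ?J (loc s) i" using DJ by (auto simp: at_loc_def)
    then have eq: "at_loc D (loc s) i = at_loc ?J (loc s) i"
      using card_at_loc_le_cap[OF S st _ i] c j DJ
      by (intro card_seteq finite_at_loc) auto
    show "at_loc ?J (loc s) i \<subseteq> D" unfolding eq[symmetric] by (auto simp: at_loc_def)
    show "card (at_loc ?J (loc s) i) = cap S i" using c eq by simp
  qed (use that DJ in auto)
  moreover have "B \<subseteq> (?f ^^ r) ?J" if "blocking S s B" for B r
  proof (induction r)
    case 0
    then show ?case using that by (simp add: blocks_def)
  next
    case (Suc r)
    then show ?case using blocking_sweep[OF that] sweeps_subset by simp
  qed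
  then have "D \<noteq> {}" if "blocking S s B" for B
  proof -
    have "B \<noteq> {}" using that by (simp add: blocks_def)
    moreover have "B \<subseteq> D" using that \<open>\<And>B r. blocking S s B \<Longrightarrow> B \<subseteq> (?f ^^ r) ?J\<close> D_def by blast
    ultimately show ?thesis by blast
  qed
  ultimately show ?thesis unfolding D_def by blast
qed

section \<open>Pruning as a program\<close>

text \<open>\<open>vE\<close> stays 1 if the row is empty, and \<open>vF\<close> becomes 1 if a
  visited machine has room; their sum is positive exactly when the job is not stuck. The row is
  traversed for discarded jobs as well, which keeps \<open>vP\<close> aligned with the rows.\<close>

definition visit_com :: com where
  "visit_com = Set vF 0 ;; Set vE 1 ;;
     For vI vM (Inc vP ;; Get vT Req vP ;;
       Cond vT (Set vE 0 ;; Get vD Free vI ;; Cond vD (Set vF 1) Skip) Skip) ;;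
     Plus vF vF vE ;; Get vT Live vJ ;;
     Cond vT
       (Cond vF (Set vT 0 ;; Put Live vJ vT ;;
          Get vL Loc vJ ;; Get vT Free vL ;; Inc vT ;; Put Free vL vT) Skip)
       Skip"

lemma wp_visit_com:
  assumes S: "is_open_shop S" and a: "a < njobs S" and A: "memory S s (njobs S) D A"
    and V: "V vM = nmach S" "V vP = a * nmach S" "V vJ = Suc a"
  shows "wp visit_com (\<lambda>t V' A' w'. t \<le> nmach S * 11 + 20 \<and>
     agree {vI, vK, vP, vT, vE, vD, vF, vL} V V' \<and> V' vP = Suc a * nmach S \<and>
     memory S s (njobs S) (visit S s (Suc a) D) A' \<and> w' = w) V A w"
proof -
  let ?m = "nmach S" and ?j = "Suc a"
  let ?R = "visited S s ?j"
  let ?V = "V(vF := 0, vE := 1)"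
  let ?X = "{vI, vK, vP, vT, vE, vD, vF}"
  let ?I = "\<lambda>i V' A' w'. agree ?X V V' \<and> A' = A \<and> w' = w \<and> V' vP = a * ?m + i \<and>
     V' vE = of_bool (?R \<inter> {1..i} = {}) \<and> V' vF = of_bool (\<exists>k\<in>?R \<inter> {1..i}. A Free k \<noteq> 0)"
  have R: "?R \<subseteq> {1..?m}" using visited_subset[OF S] a by auto
  then have R': "?R \<inter> {1..?m} = ?R" by blast
  have req: "A Req (a * ?m + i) = of_bool (i \<in> ?R)" if "i \<in> {1..?m}" for i
    using A a that unfolding memory_def
    by (metis Suc_le_eq atLeastAtMost_iff diff_Suc_1 le_add1 plus_1_eq_Suc)
  have jJ: "?j \<in> {1..njobs S}" using a by auto
  have D: "D \<subseteq> {1..njobs S}" "finite D" using A finite_subset by (auto simp: memory_def)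
  have free: "A Free i + card (at_loc D (loc s) i) = cap S i" if "i \<in> {1..?m}" for i
    using A that by (auto simp: memory_def)
  \<comment> \<open>\<open>Free\<close> counts room relative to the live jobs, so being filled by
    \<open>D\<close> is a test for 0.\<close>
  have stuck: "stuck S s D ?j \<longleftrightarrow> \<not> ((\<exists>k\<in>?R. A Free k \<noteq> 0) \<or> ?R = {})"
  proof -
    have "card (at_loc D (loc s) i) = cap S i \<longleftrightarrow> A Free i = 0" if "i \<in> ?R" for i
    proof -
      have "i \<in> {1..?m}" using R that by blast
      then show ?thesis using free[of i] by linarith
    qed
    then show ?thesis unfolding stuck_def by auto
  qed
  have loop: "wp (For vI vM (Inc vP ;; Get vT Req vP ;;
       Cond vT (Set vE 0 ;; Get vD Free vI ;; Cond vD (Set vF 1) Skip) Skip))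
     (\<lambda>t V' A' w'. t \<le> ?m * (8 + 3) + 3 \<and> V' vM = ?m \<and> ?I ?m V' A' w') ?V A w"
  proof (rule wp_For[where I = ?I], goal_cases)
    case (6 i V' A' w')
    have "{1..Suc i} = insert (Suc i) {1..i}" by auto
    moreover have "A Req (Suc (a * ?m + i)) = of_bool (Suc i \<in> ?R)" using req[of "Suc i"] 6 by simp
    ultimately show ?case using 6 by (auto simp: wp_simps)
  qed (use V in \<open>auto simp: agree_def\<close>)
  \<comment> \<open>Discarding a live job returns its place to \<open>Free\<close>.\<close>
  let ?A' = "A(Live := (A Live)(?j := 0), Free := (A Free)(loc s ?j := Suc (A Free (loc s ?j))))"
  have kill: "memory S s (njobs S) (D - {?j}) ?A'" if "?j \<in> D"
    unfolding memory_def
  proof (intro conjI ballI)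
    fix i assume i: "i \<in> {1..?m}"
    have eq: "at_loc (D - {?j}) (loc s) i = at_loc D (loc s) i - {?j}" by (auto simp: at_loc_def)
    have fin: "finite (at_loc D (loc s) i)" using D finite_at_loc by blast
    have "card (at_loc (D - {?j}) (loc s) i) + of_bool (loc s ?j = i) = card (at_loc D (loc s) i)"
    proof (cases "loc s ?j = i")
      case True
      then have "?j \<in> at_loc D (loc s) i" using that by (simp add: at_loc_def)
      then show ?thesis using card_Suc_Diff1[OF fin] True unfolding eq by simp
    next
      case False
      then have "?j \<notin> at_loc D (loc s) i" by (simp add: at_loc_def)
      then show ?thesis using False unfolding eq by simp
    qed
    then show "?A' Free i + card (at_loc (D - {?j}) (loc s) i) = cap S i"
      using free[OF i] by auto
  qed (use A in \<open>auto simp: memory_def\<close>)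
  have live: "A Live ?j = of_bool (?j \<in> D)" "A Loc ?j = loc s ?j"
    using A jJ by (auto simp: memory_def)
  show ?thesis
    unfolding visit_com_def wp_simps(2) wp_Seq
  proof (rule wp_mono[OF loop], goal_cases)
    case (1 t V' A' w')
    then have *: "A' = A" "w' = w" by blast+
    have v: "V' vJ = ?j" using 1 V by (auto simp: agree_def)
    have e: "V' vE = of_bool (?R = {})" "V' vF = of_bool (\<exists>k\<in>?R. A Free k \<noteq> 0)"
      using 1 unfolding R' by blast+
    have s0: "0 < V' vF \<or> 0 < V' vE \<longleftrightarrow> \<not> stuck S s D ?j" unfolding stuck e by auto
    have t: "t \<le> ?m * 11 + 3" and ag: "agree ?X V V'" and vP: "V' vP = Suc a * ?m"
      using 1 by auto
    show ?case
    proof (cases "stuck S s D ?j \<or> ?j \<notin> D")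
      case True
      then have "visit S s ?j D = D" by (auto simp: visit_def)
      then show ?thesis using True t ag vP A unfolding *
        by (auto simp: wp_simps v live s0 agree_def)
    next
      case False
      then have "visit S s ?j D = D - {?j}" by (auto simp: visit_def)
      then show ?thesis using False t ag vP kill unfolding *
        by (auto simp: wp_simps v live s0 agree_def)
    qed
  qed
qed

text \<open>As many sweeps as jobs are always enough, so no test for stabilisation is made;
  \<open>vP\<close> restarts at the first row each time.\<close>

definition prune :: com where
  "prune = For vR vN (Set vP 0 ;; For vJ vN visit_com)"

lemma wp_sweep:
  assumes S: "is_open_shop S" and A: "memory S s (njobs S) D A"
    and V: "V vN = njobs S" "V vM = nmach S" "V vP = 0"
  shows "wp (For vJ vN visit_com) (\<lambda>t V' A' w'. t \<le> njobs S * (nmach S * 11 + 20 + 3) + 3 \<and>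
     agree {vJ, vI, vK, vP, vT, vE, vD, vF, vL} V V' \<and>
     memory S s (njobs S) (sweep S s (njobs S) D) A' \<and> w' = w) V A w"
proof -
  let ?I = "\<lambda>a V' A' w'. agree {vJ, vI, vK, vP, vT, vE, vD, vF, vL} V V' \<and> V' vP = a * nmach S \<and>
     memory S s (njobs S) (sweep S s a D) A' \<and> w' = w"
  have "wp (For vJ vN visit_com) (\<lambda>t V' A' w'. t \<le> njobs S * (nmach S * 11 + 20 + 3) + 3 \<and>
     V' vN = njobs S \<and> ?I (njobs S) V' A' w') V A w"
  proof (rule wp_For[where I = ?I], goal_cases)
    case (6 a V' A' w')
    then show ?case
      by (intro wp_mono[OF wp_visit_com[OF S, of a s "sweep S s a D"]])
        (use V in \<open>auto simp: agree_def sweep_Suc\<close>)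
  qed (use V A in \<open>auto simp: sweep_0 agree_def\<close>)
  then show ?thesis by (rule wp_mono) auto
qed

lemma wp_prune:
  assumes S: "is_open_shop S" and A: "memory S s (njobs S) D A"
    and V: "V vN = njobs S" "V vM = nmach S"
  shows "wp prune
     (\<lambda>t V' A' w'. t \<le> njobs S * (njobs S * (nmach S * 11 + 20 + 3) + 4 + 3) + 3 \<and>
     agree {vR, vJ, vI, vK, vP, vT, vE, vD, vF, vL} V V' \<and>
     memory S s (njobs S) ((sweep S s (njobs S) ^^ njobs S) D) A') V A w"
proof -
  let ?I = "\<lambda>r V' A' w'. agree {vR, vJ, vI, vK, vP, vT, vE, vD, vF, vL} V V' \<and>
     memory S s (njobs S) ((sweep S s (njobs S) ^^ r) D) A'"
  have "wp prune (\<lambda>t V' A' w'.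
     t \<le> njobs S * (njobs S * (nmach S * 11 + 20 + 3) + 4 + 3) + 3 \<and>
     V' vN = njobs S \<and> ?I (njobs S) V' A' w') V A w"
    unfolding prune_def
  proof (rule wp_For[where I = ?I], goal_cases)
    case (6 r V' A' w')
    let ?V = "V'(vP := 0)"
    have ag: "agree {vR, vJ, vI, vK, vP, vT, vE, vD, vF, vL} V V'"
      and m: "memory S s (njobs S) ((sweep S s (njobs S) ^^ r) D) A'" using 6 by blast+
    have v: "?V vN = njobs S" "?V vM = nmach S" "?V vP = 0"
      using ag V by (simp_all add: agree_def)
    show ?case unfolding wp_simps
    proof (rule wp_mono[OF wp_sweep[OF S m v]], goal_cases)
      case (1 t V2 A2 w2)
      have "agree {vR, vJ, vI, vK, vP, vT, vE, vD, vF, vL} V ?V"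
        using ag by (simp only: agree_upd insert_iff simp_thms)
      moreover have "agree {vJ, vI, vK, vP, vT, vE, vD, vF, vL} ?V V2" using 1 by blast
      ultimately have "agree {vR, vJ, vI, vK, vP, vT, vE, vD, vF, vL} V V2"
        by (rule agree_trans) auto
      moreover have "V2 vR = Suc r" "V2 vN = njobs S"
        using 1 6 by (simp_all add: agree_def)
      moreover have "memory S s (njobs S) ((sweep S s (njobs S) ^^ Suc r) D) A2"
        using 1 by (simp only: funpow.simps o_def)
      moreover have "1 + t \<le> njobs S * (nmach S * 11 + 20 + 3) + 4" using 1 by linarith
      ultimately show ?case by blast
    qed
  qed (use V A in \<open>auto simp: agree_def\<close>)
  then show ?thesis by (rule wp_mono) auto
qed

definition check_live :: com where
  "check_live = For vJ vN (Get vT Live vJ ;; Cond vT (Set vOk 0) Skip)"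

lemma wp_check_live:
  assumes A: "memory S s (njobs S) D A" and V: "V vN = njobs S" "V vOk = of_bool ok"
  shows "wp check_live (\<lambda>t V' A' w'. t \<le> njobs S * (3 + 3) + 3 \<and>
     V' vOk = of_bool (ok \<and> D = {})) V A w"
proof -
  let ?I = "\<lambda>a V' A' w'. A' = A \<and> V' vOk = of_bool (ok \<and> D \<inter> {1..a} = {})"
  have "wp check_live (\<lambda>t V' A' w'. t \<le> njobs S * (3 + 3) + 3 \<and>
     V' vN = njobs S \<and> ?I (njobs S) V' A' w') V A w"
    unfolding check_live_def
  proof (rule wp_For[where I = ?I], goal_cases)
    case (6 a V' A' w')
    have "A Live (Suc a) = of_bool (Suc a \<in> D)" using A 6 by (auto simp: memory_def)
    moreover have "{1..Suc a} = insert (Suc a) {1..a}" by auto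
    ultimately show ?case using 6 by (auto simp: wp_simps)
  qed (use V in auto)
  moreover have "D \<inter> {1..njobs S} = D" using A by (auto simp: memory_def)
  ultimately show ?thesis by (elim wp_mono) auto
qed

section \<open>The decision procedure\<close>

definition decide :: com where
  "decide = read_nat vN ;; read_nat vM ;; read_caps ;; Set vOk 1 ;; read_jobs ;;
     prune ;; check_live"

text \<open>The time bounds of the phases, with the numbers of jobs and machines and all code
  lengths replaced by the input length \<open>L\<close>.\<close>

definition time_bound :: "nat poly" where
  "time_bound = (let L = [:0, 1:] in
     (5 * L + 5) + (5 * L + 5) + (L * (9 + 5 * L) + 3) + 1 +
     (L * (L * 29 + 5 * L + 19 + 3) + 3) +
     (L * (L * (L * 11 + 20 + 3) + 4 + 3) + 3) + (L * (3 + 3) + 3))"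

lemma poly_time_bound:
  "poly time_bound L =
     (5 * L + 5) + (5 * L + 5) + (L * (9 + 5 * L) + 3) + 1 +
     (L * (L * 29 + 5 * L + 19 + 3) + 3) +
     (L * (L * (L * 11 + 20 + 3) + 4 + 3) + 3) + (L * (3 + 3) + 3)"
  by (simp add: time_bound_def algebra_simps)

lemma length_le_length_concat: "x \<in> set xs \<Longrightarrow> length x \<le> length (concat xs)"
  by (induction xs) auto

text \<open>Bounds the numbers of jobs and machines by the input length: their binary codes are too
  short for that, but there is a nonempty block for every job and every machine.\<close>

lemma length_le_length_concat_map:
  "(\<And>x. x \<in> set xs \<Longrightarrow> f x \<noteq> []) \<Longrightarrow> length xs \<le> length (concat (map f xs))"
proof (induction xs)
  case (Cons x xs)
  then have "length (f x) \<ge> 1" by (cases "f x") auto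
  with Cons show ?case by simp
qed simp

lemma enc_nat_not_Nil: "enc_nat x \<noteq> []"
  by (simp add: enc_nat_def)

lemma wp_decide:
  assumes S: "is_open_shop S" and st: "is_state S s"
  shows "wp decide (\<lambda>t V' A' w'. t \<le> poly time_bound (length (enc_instance (S, s))) \<and>
     V' vOk = of_bool (reachable S s)) (\<lambda>_. 0) A (enc_instance (S, s))"
proof -
  let ?n = "njobs S" and ?m = "nmach S"
  let ?caps = "concat (map (\<lambda>i. enc_nat (cap S i)) [1..<?m + 1])"
  let ?jobs = "concat (map (enc_job S s) [1..<?n + 1])"
  define L where "L = length (enc_instance (S, s))"
  have enc: "enc_instance (S, s) = enc_nat ?n @ (enc_nat ?m @ (?caps @ ?jobs))"
    by (simp add: enc_job_def[abs_def])
  have len: "length (enc_nat ?n) \<le> L" "length (enc_nat ?m) \<le> L" "length ?caps \<le> L"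
      "length ?jobs \<le> L"
    unfolding L_def enc by simp_all
  have "?m \<le> length ?caps"
    using length_le_length_concat_map[of "[1..<?m + 1]" "\<lambda>i. enc_nat (cap S i)"]
    by (simp add: enc_nat_not_Nil del: upt_Suc)
  then have m: "?m \<le> L" using len by simp
  have "?n \<le> length ?jobs"
    using length_le_length_concat_map[of "[1..<?n + 1]" "enc_job S s"]
    by (simp add: enc_nat_not_Nil enc_job_def del: upt_Suc)
  then have n: "?n \<le> L" using len by simp
  have caps: "length (enc_nat (cap S i)) \<le> L" if "i \<in> {1..?m}" for i
    using length_le_length_concat[of "enc_nat (cap S i)" "map (\<lambda>i. enc_nat (cap S i)) [1..<?m + 1]"]
      that len(3) by (auto simp del: upt_Suc)
  have locs: "length (enc_nat (loc s j)) \<le> L" if "j \<in> {1..?n}" for j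
  proof -
    have "length (enc_nat (loc s j)) \<le> length (enc_job S s j)" by (simp add: enc_job_def)
    also have "\<dots> \<le> length ?jobs"
      using that by (intro length_le_length_concat) (auto simp del: upt_Suc)
    finally show ?thesis using len by simp
  qed
  let ?D = "(sweep S s ?n ^^ ?n) {1..?n}"
  have reach: "reachable S s \<longleftrightarrow> consistent S s \<and> ?D = {}"
    unfolding sweeps_empty_iff[OF S st] by (rule reachable_iff[OF S st])
  let ?t1 = "5 * L + 5" and ?t2 = "?m * (9 + 5 * L) + 3"
  let ?t3 = "?n * (?m * 29 + 5 * L + 19 + 3) + 3"
  let ?t4 = "?n * (?n * (?m * 11 + 20 + 3) + 4 + 3) + 3" and ?t5 = "?n * (3 + 3) + 3"
  have "?t1 + ?t1 + ?t2 + 1 + ?t3 + ?t4 + ?t5 \<le> poly time_bound L"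
    unfolding poly_time_bound by (intro add_mono mult_mono m n order_refl) auto
  \<comment> \<open>The sum is nested to the right as the successive uses of \<open>wp_Seq\<close>
    produce it.\<close>
  then have bound: "t1 + (t2 + (t3 + (1 + (t4 + (t5 + t6))))) \<le> poly time_bound L"
    if "t1 \<le> ?t1" "t2 \<le> ?t1" "t3 \<le> ?t2" "t4 \<le> ?t3" "t5 \<le> ?t4" "t6 \<le> ?t5" for t1 t2 t3 t4 t5 t6
    using that by linarith
  have "wp decide (\<lambda>t V' A' w'. t \<le> poly time_bound L \<and> V' vOk = of_bool (reachable S s))
     (\<lambda>_. 0) A (enc_nat ?n @ (enc_nat ?m @ (?caps @ ?jobs)))"
    unfolding decide_def wp_Seq wp_Set
  proof (rule wp_mono[OF wp_read_nat[OF _ len(1)]], goal_cases)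
    case (2 t1 V1 A1 w1)
    then have *: "w1 = enc_nat ?m @ (?caps @ ?jobs)" by blast
    show ?case unfolding *
    proof (rule wp_mono[OF wp_read_nat[OF _ len(2)]], goal_cases)
      case b: (2 t2 V2 A2 w2)
      then have *: "w2 = ?caps @ ?jobs" by blast
      show ?case unfolding *
      proof (rule wp_mono[OF wp_read_caps[where L = L]], goal_cases)
        case c: (3 t3 V3 A3 w3)
        then have *: "w3 = ?jobs" by blast
        show ?case unfolding *
        proof (rule wp_mono[OF wp_read_jobs[OF S st, where L = L]], goal_cases)
          case d: (7 t4 V4 A4 w4)
          show ?case
          proof (rule wp_mono[OF wp_prune[OF S, of s "{1..?n}"]], goal_cases)
            case e: (4 t5 V5 A5 w5)
            show ?case
            proof (rule wp_mono[OF wp_check_live[of S s ?D _ _ "consistent S s"]], goal_cases)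
              case f: (4 t6 V6 A6 w6)
              then show ?case using bound[of t1 t2 t3 t4 t5 t6] 2 b c d e unfolding reach by blast
            qed (use d e in \<open>auto simp: agree_def\<close>)
          qed (use d in auto)
        qed (use 2 b c locs in \<open>auto simp: agree_def\<close>)
      qed (use b caps in auto)
    qed simp
  qed simp
  then show ?thesis by (simp only: L_def enc)
qed

definition program :: "instr list" where
  "program = compile decide 0 @ [Jump (reg vOk) (size_of decide + 2), Reject, Accept]"

text \<open>\<open>10 * T + 1\<close> counts the compiled steps and the jump on \<open>vOk\<close>;
  the last summand 1 pays for \<open>Accept\<close> or \<open>Reject\<close>.\<close>

lemma wp_run:
  assumes "wp decide (\<lambda>t V' A' w'. t \<le> T \<and> V' vOk = of_bool b) (\<lambda>_. 0) (\<lambda>_ _. 0) w"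
    "\<forall>ins\<in>set program. instr_bound K ins" "K \<ge> 1"
  shows "\<exists>t. run program (0, (\<lambda>_. 0), w) t b \<and> t \<le> (10 * T + 1) * (5 * (K + 10 * T + 2)) + 1"
proof -
  let ?n = "size_of decide"
  obtain t V' A' w' where big: "big decide ((\<lambda>_. 0), (\<lambda>_ _. 0), w) t (V', A', w')"
    and t: "t \<le> T" and V': "V' vOk = of_bool b"
    using assms(1) unfolding wp_def by blast
  have zero: "((\<lambda>_. 0), (\<lambda>_ _. 0), w) = (vars_of (\<lambda>_. 0), arrs_of (\<lambda>_. 0), w)"
    by (simp add: vars_of_def arrs_of_def)
  have "code_at program 0 (compile decide 0)"
    using code_at_self[of "[]"] by (simp add: program_def)
  from compile_correct[OF big this zero] obtain X' k where
    k: "steps program (0, (\<lambda>_. 0), w) k (?n, X', w')" "k \<le> 10 * t" and "V' = vars_of X'"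
    by auto
  then have X': "X' (reg vOk) = of_bool b" using V' by (simp add: vars_of_def)
  have len: "length program = ?n + 3" by (simp add: program_def)
  have nth: "program ! ?n = Jump (reg vOk) (?n + 2)" "program ! (?n + 1) = Reject"
    "program ! (?n + 2) = Accept"
    by (simp_all add: program_def nth_append)
  let ?p = "if b then ?n + 2 else ?n + 1"
  have "steps program (?n, X', w') 1 (?p, X', w')"
    by (rule steps_one) (use len nth X' in auto)
  from steps_trans[OF k(1) this]
  have st: "steps program (0, (\<lambda>_. 0), w) (k + 1) (?p, X', w')" .
  have "run program (?p, X', w') 1 b"
    using run.accept[of "?n + 2" program] run.reject[of "?n + 1" program] len nth by (cases b) auto
  from steps_run[OF st this refl assms(2) _ assms(3)] obtain t' where
    t': "run program (0, (\<lambda>_. 0), w) t' b" "t' \<le> (k + 1) * (5 * Suc (K + (k + 1))) + 1" by auto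
  have "(k + 1) * (5 * Suc (K + (k + 1))) \<le> (10 * T + 1) * (5 * (K + 10 * T + 2))"
    using k(2) t by (intro mult_mono) auto
  with t' show ?thesis by (intro exI[of _ t']) auto
qed

theorem theorem4p3:
  "polytime_decidable {(S, s). is_open_shop S \<and> is_state S s} enc_instance
     (\<lambda>(S, s). reachable S s)"
proof -
  obtain K0 where "\<forall>ins\<in>set program. instr_bound K0 ins" using program_bound_ex by blast
  \<comment> \<open>\<open>Suc\<close> provides the bound of at least 1 that \<open>wp_run\<close>
    asks for.\<close>
  then have K: "\<forall>ins\<in>set program. instr_bound (Suc K0) ins"
    using instr_bound_mono[OF _ le_SucI[OF order_refl]] by blast
  let ?p = "(10 * time_bound + 1) * (5 * ([:Suc K0:] + 10 * time_bound + 2)) + 1"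
  have p: "poly ?p L = (10 * poly time_bound L + 1) * (5 * (Suc K0 + 10 * poly time_bound L + 2)) + 1"
    for L by simp
  have "\<exists>t. run program (0, (\<lambda>_. 0), enc_instance (S, s)) t (reachable S s) \<and>
      t \<le> poly ?p (length (enc_instance (S, s)))" if "is_open_shop S" "is_state S s" for S s
    unfolding p by (rule wp_run[OF wp_decide[OF that] K]) simp
  then show ?thesis
    unfolding polytime_decidable_def by (intro exI[of _ program] exI[of _ ?p]) auto
qed

end
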